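(* Let $W,V>1$ be powers of $2$, $M\ge 1$ and $r\in(0,1]$. Algorithm SA (described in the context) with admittance probability $r$ and with the logarithmic classification is $$O\left(\frac{M}{r}\log_2 W\log_2 V\right)\text{-competitive},$$ i.e. there is a universal constant $C$ such that for every finite arrival sequence with at most $M$ unknown packets per cycle, the throughput of any offline algorithm is at most $C\,\frac{M}{r}\log_2W\log_2V$ times the expected throughput of SA.
   Context: Model. Time is divided into discrete cycles, each consisting of three steps: (i) transmission: fully processed packets leave the queue; (ii) arrival: new packets may arrive one after the other, and the algorithm decides which to accept and which currently buffered packets to push out and drop; (iii) processing: a single buffered packet receives one processing cycle. The buffer (of the online and of the offline algorithm) holds at most $B\ge 2$ packets. Packets have unit size; packet $p$ has profit $v(p)\in\{1,\dots,V\}$ (gained when transmitted) and work $w(p)\in\{1,\dots,W\}$ (number of processing cycles needed before transmission). On arrival the characteristics $(w(p),v(p))$ are either known (a $K$-packet) or unknown (a $U$-packet); those of a $U$-packet become known once it undergoes its first processing cycle ("parsing"), which counts as one of its $w(p)$ cycles. At most $M$ $U$-packets arrive per cycle. Throughput is the total profit of all packets eventually transmitted. Offline algorithms know the whole arrival sequence and all characteristics. Logarithmic classification. Let $X_1=[1,2]$ and $X_i=[2^{i-1}+1,2^i]$ for $i>1$. A packet is in work-class $i$ if its total work is in $X_i$ ($i=1,\dots,\ell_W=\log_2W$), and in profit-class $j$ if its profit is in $X_j$ ($j=1,\dots,\ell_V=\log_2V$); it is in combined class $C_{(i,j)}$ if both hold (total work $w(p)$, not remaining work, is used). Algorithm SA.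 At initialization pick $i^*\in\{1,\dots,\ell_W\}$ and $j^*\in\{1,\dots,\ell_V\}$ independently and uniformly at random; the selected class is $G=C_{(i^*,j^* )}$. A $G^K$-packet is a packet in $G$ whose characteristics are currently known. The buffer is Gfull if it contains $B$ $G^K$-packets. Priority order of buffered packets: the admitted packet (if any) first, then $G^K$-packets, then all other packets; ties are broken by FIFO. "Making room" means: if the buffer is full, drop the lowest-priority packet. A variable phase (initially fill) is updated as follows: set to fill if the buffer is empty, to flush if the buffer is Gfull, otherwise left unchanged. In each cycle, after transmission: (1) update phase; (2) independently declare the cycle an admittance cycle with probability $r$; (3) while phase is fill and there is a further arriving packet $p$: (a) if $p$ is a $G^K$-packet: if the buffer contains $B-1$ $G^K$-packets, drop the admitted packet if one exists; then make room and accept $p$; (b) if $p$ is a $U$-packet and the cycle is an admittance cycle: if $p$ is the first $U$-packet of this cycle, make room, accept $p$ and mark it admitted; if it is the $m$-th one, $m\ge2$, then with probability $1/m$ replace the admitted packet by $p$ (which becomes the admitted packet); (c) if $p$ has not been accepted and the buffer is not full, accept $p$; then update phase. Packets arriving while phase is flush are discarded. (4) In the processing step, process the highest-priority buffered packet for one cycle; the mark "admitted" is then removed; update phase. *)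

theory Defs
  imports "HOL-Probability.Probability" "HOL-Library.Multiset" "HOL-Library.Monad_Syntax"
begin

section \<open>Packets and arrival sequences\<close>

text \<open>A packet with \<open>announced\<close> is a K-packet, one without is a U-packet.\<close>

record packet =
  work :: nat
  profit :: nat
  announced :: bool

text \<open>A buffered packet together with the number of processing cycles it has received so far.\<close>

record job =
  pkt :: packet
  served :: nat

definition finished :: "'a job_scheme \<Rightarrow> bool" where
  "finished j \<longleftrightarrow> served j \<ge> work (pkt j)"

definition serve :: "'a job_scheme \<Rightarrow> 'a job_scheme" where
  "serve j = j\<lparr>served := Suc (served j)\<rparr>"

text \<open>A finite arrival sequence lists, cycle by cycle, the packets in their order of arrival;
  time goes on without arrivals afterwards.\<close>

type_synonym arrival_seq = "packet list list"

definition arrivals :: "arrival_seq \<Rightarrow> nat \<Rightarrow> packet list" where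
  "arrivals \<sigma> t = (if t < length \<sigma> then \<sigma> ! t else [])"

definition valid_arrivals :: "nat \<Rightarrow> nat \<Rightarrow> nat \<Rightarrow> arrival_seq \<Rightarrow> bool" where
  "valid_arrivals M W V \<sigma> \<longleftrightarrow>
     (\<forall>ps \<in> set \<sigma>.
        length (filter (\<lambda>p. \<not> announced p) ps) \<le> M \<and>
        (\<forall>p \<in> set ps. work p \<in> {1..W} \<and> profit p \<in> {1..V}))"

section \<open>Offline algorithms\<close>

text \<open>Whenever a packet arrives, an arbitrary part of the buffer contents and the new packet may be
  kept, as long as the buffer bound is respected. Since an offline algorithm knows all
  characteristics, every schedule obeying these rules is admitted.\<close>

inductive offline_arrivals :: "nat \<Rightarrow> job multiset \<Rightarrow> packet list \<Rightarrow> job multiset \<Rightarrow> bool"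
  for B :: nat where
  stop: "Q' \<subseteq># Q \<Longrightarrow> offline_arrivals B Q [] Q'"
| arrive: "Q' \<subseteq># add_mset \<lparr>pkt = p, served = 0\<rparr> Q \<Longrightarrow> size Q' \<le> B \<Longrightarrow>
    offline_arrivals B Q' ps Q'' \<Longrightarrow> offline_arrivals B Q (p # ps) Q''"

text \<open>Idling is permitted.\<close>

definition offline_process :: "job multiset \<Rightarrow> job multiset \<Rightarrow> bool" where
  "offline_process Q Q' \<longleftrightarrow> Q' = Q \<or> (\<exists>j \<in># Q. Q' = add_mset (serve j) (Q - {#j#}))"

text \<open>\<open>Q t\<close> is the buffer at the beginning of cycle \<open>t\<close>; its finished packets are
  transmitted first in that cycle.\<close>

definition offline_schedule :: "nat \<Rightarrow> arrival_seq \<Rightarrow> (nat \<Rightarrow> job multiset) \<Rightarrow> bool" where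
  "offline_schedule B \<sigma> Q \<longleftrightarrow>
     Q 0 = {#} \<and>
     (\<forall>t. \<exists>A. offline_arrivals B (filter_mset (\<lambda>j. \<not> finished j) (Q t)) (arrivals \<sigma> t) A \<and>
              offline_process A (Q (Suc t)))"

definition offline_throughput :: "(nat \<Rightarrow> job multiset) \<Rightarrow> ennreal" where
  "offline_throughput Q = (\<Sum>t. of_nat (\<Sum>j \<in># filter_mset finished (Q t). profit (pkt j)))"

section \<open>Logarithmic classification\<close>

definition X :: "nat \<Rightarrow> nat set" where
  "X i = (if i = 1 then {1..2} else {2 ^ (i - 1) + 1 .. 2 ^ i})"

definition combined_class :: "nat \<Rightarrow> nat \<Rightarrow> packet set" where
  "combined_class i j = {p. work p \<in> X i \<and> profit p \<in> X j}"

definition num_classes :: "nat \<Rightarrow> nat" where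
  "num_classes N = nat \<lfloor>log 2 (real N)\<rfloor>"

section \<open>Algorithm SA\<close>

record sa_job = job +
  admitted :: bool

text \<open>Accepted packets are appended, so the list order is the FIFO order.\<close>

type_synonym sa_buffer = "sa_job list"

datatype phase = Fill | Flush

text \<open>In what follows \<open>G\<close> is the selected class. The first processing cycle reveals the
  characteristics of a U-packet.\<close>

definition known :: "'a job_scheme \<Rightarrow> bool" where
  "known j \<longleftrightarrow> announced (pkt j) \<or> served j > 0"

definition GK :: "packet set \<Rightarrow> 'a job_scheme \<Rightarrow> bool" where
  "GK G j \<longleftrightarrow> pkt j \<in> G \<and> known j"

definition num_GK :: "packet set \<Rightarrow> sa_buffer \<Rightarrow> nat" where
  "num_GK G q = length (filter (GK G) q)"

definition rank :: "packet set \<Rightarrow> sa_job \<Rightarrow> nat" where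
  "rank G j = (if admitted j then 0 else if GK G j then 1 else 2)"

text \<open>Positions of the highest-priority and lowest-priority packet. Smaller rank means higher
  priority; among equal ranks the earlier position has the higher priority.\<close>

definition highest :: "packet set \<Rightarrow> sa_buffer \<Rightarrow> nat" where
  "highest G q = (LEAST i. i < length q \<and> (\<forall>k < length q. rank G (q ! i) \<le> rank G (q ! k)))"

definition lowest :: "packet set \<Rightarrow> sa_buffer \<Rightarrow> nat" where
  "lowest G q = (GREATEST i. i < length q \<and> (\<forall>k < length q. rank G (q ! k) \<le> rank G (q ! i)))"

definition make_room :: "nat \<Rightarrow> packet set \<Rightarrow> sa_buffer \<Rightarrow> sa_buffer" where
  "make_room B G q =
     (if length q = B then take (lowest G q) q @ drop (Suc (lowest G q)) q else q)"

definition drop_admitted :: "sa_buffer \<Rightarrow> sa_buffer" where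
  "drop_admitted q = filter (\<lambda>j. \<not> admitted j) q"

definition accept :: "packet \<Rightarrow> bool \<Rightarrow> sa_buffer \<Rightarrow> sa_buffer" where
  "accept p a q = q @ [\<lparr>pkt = p, served = 0, admitted = a\<rparr>]"

definition update_phase :: "nat \<Rightarrow> packet set \<Rightarrow> sa_buffer \<Rightarrow> phase \<Rightarrow> phase" where
  "update_phase B G q ph = (if q = [] then Fill else if num_GK G q = B then Flush else ph)"

text \<open>Arrival of a packet \<open>p\<close> in phase \<open>Fill\<close>. The flag \<open>a\<close> tells whether the cycle is an
  admittance cycle; if \<open>p\<close> is a U-packet, it is the \<open>m\<close>-th one of the cycle.\<close>

definition sa_offer ::
  "nat \<Rightarrow> packet set \<Rightarrow> bool \<Rightarrow> nat \<Rightarrow> packet \<Rightarrow> sa_buffer \<Rightarrow> sa_buffer pmf" where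
  "sa_offer B G a m p q =
     (let otherwise = return_pmf (if length q < B then accept p False q else q) in
      if announced p \<and> p \<in> G then
        return_pmf (accept p False
          (make_room B G (if num_GK G q = B - 1 then drop_admitted q else q)))
      else if \<not> announced p \<and> a then
        (if m = 1 then return_pmf (accept p True (make_room B G q))
         else do {
           b \<leftarrow> bernoulli_pmf (1 / real m);
           if b then return_pmf (accept p True (drop_admitted q)) else otherwise
         })
      else otherwise)"

text \<open>The argument \<open>m\<close> counts the U-packets that have arrived so far in the cycle.\<close>

fun sa_arrivals ::
  "nat \<Rightarrow> packet set \<Rightarrow> bool \<Rightarrow> nat \<Rightarrow> packet list \<Rightarrow> phase \<times> sa_buffer \<Rightarrow> (phase \<times> sa_buffer) pmf"
where
  "sa_arrivals B G a m [] (ph, q) = return_pmf (ph, q)"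
| "sa_arrivals B G a m (p # ps) (ph, q) =
     (if ph = Flush then return_pmf (ph, q)
      else
        let m' = (if announced p then m else Suc m) in
        do {
          q' \<leftarrow> sa_offer B G a m' p q;
          sa_arrivals B G a m' ps (update_phase B G q' ph, q')
        })"

definition sa_process :: "packet set \<Rightarrow> sa_buffer \<Rightarrow> sa_buffer" where
  "sa_process G q =
     map (\<lambda>j. j\<lparr>admitted := False\<rparr>)
       (if q = [] then [] else q[highest G q := serve (q ! highest G q)])"

record sa_state =
  phase :: phase
  buffer :: sa_buffer
  gain :: nat  \<comment> \<open>total profit transmitted so far\<close>

definition sa_cycle ::
  "nat \<Rightarrow> packet set \<Rightarrow> real \<Rightarrow> packet list \<Rightarrow> sa_state \<Rightarrow> sa_state pmf" where
  "sa_cycle B G r ps s =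
     (let sent = filter finished (buffer s);
          q1 = filter (\<lambda>j. \<not> finished j) (buffer s);
          ph1 = update_phase B G q1 (phase s)
      in do {
        a \<leftarrow> bernoulli_pmf r;
        (ph2, q2) \<leftarrow> sa_arrivals B G a 0 ps (ph1, q1);
        let q3 = sa_process G q2;
        return_pmf \<lparr>phase = update_phase B G q3 ph2, buffer = q3,
          gain = gain s + (\<Sum>j \<leftarrow> sent. profit (pkt j))\<rparr>
      })"

primrec sa_run :: "nat \<Rightarrow> packet set \<Rightarrow> real \<Rightarrow> arrival_seq \<Rightarrow> nat \<Rightarrow> sa_state pmf" where
  "sa_run B G r \<sigma> 0 = return_pmf \<lparr>phase = Fill, buffer = [], gain = 0\<rparr>"
| "sa_run B G r \<sigma> (Suc n) = sa_run B G r \<sigma> n \<bind> sa_cycle B G r (arrivals \<sigma> n)"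

text \<open>State distribution after \<open>n\<close> cycles, including the initial choice of the class.\<close>

definition SA :: "nat \<Rightarrow> nat \<Rightarrow> nat \<Rightarrow> real \<Rightarrow> arrival_seq \<Rightarrow> nat \<Rightarrow> sa_state pmf" where
  "SA B W V r \<sigma> n =
     do {
       i \<leftarrow> pmf_of_set {1..num_classes W};
       j \<leftarrow> pmf_of_set {1..num_classes V};
       sa_run B (combined_class i j) r \<sigma> n
     }"

text \<open>The gain is nondecreasing along a run, so by monotone convergence the supremum of the
  expected gains is the expectation of the total profit that is eventually transmitted.\<close>

definition SA_throughput :: "nat \<Rightarrow> nat \<Rightarrow> nat \<Rightarrow> real \<Rightarrow> arrival_seq \<Rightarrow> ennreal" where
  "SA_throughput B W V r \<sigma> =
     (SUP n. \<integral>\<^sup>+ s. of_nat (gain s) \<partial>measure_pmf (SA B W V r \<sigma> n))"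

definition SA_competitive ::
  "nat \<Rightarrow> nat \<Rightarrow> nat \<Rightarrow> nat \<Rightarrow> real \<Rightarrow> real \<Rightarrow> bool" where
  "SA_competitive B M W V r c \<longleftrightarrow>
     (\<forall>\<sigma> Q. valid_arrivals M W V \<sigma> \<longrightarrow> offline_schedule B \<sigma> Q \<longrightarrow>
        offline_throughput Q \<le> ennreal c * SA_throughput B W V r \<sigma>)"

end

theory Submission
  imports Defs
begin

text \<open>Fix the selected class \<open>G\<close>, with works in \<open>[c, 2c]\<close> and profits in \<open>[b, 2b]\<close>. An amortized
  analysis compares the numbers of \<open>G\<close>-packets handled by the two algorithms. In phase \<open>Fill\<close>, SA
  never loses a known \<open>G\<close>-packet, and a cycle without overflow whose arrivals contain \<open>x\<close> unknown
  \<open>G\<close>-packets adds in expectation at least \<open>r x / M\<close> known ones, by reservoir sampling among the at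
  most \<open>M\<close> unknown packets. A phase \<open>Flush\<close> starts with \<open>B\<close> known \<open>G\<close>-packets and takes at most
  \<open>2 c B\<close> cycles, in which any offline algorithm transmits \<open>O(B)\<close> packets of \<open>G\<close> and afterwards
  buffers at most \<open>B\<close>. A potential function turns this into a supermartingale argument, so that the
  offline profit from \<open>G\<close> is at most \<open>12 M / r\<close> times the expected gain of SA given \<open>G\<close>; summing
  over all classes costs the factor \<open>log\<^sub>2 W log\<^sub>2 V\<close>.\<close>

section \<open>Expectations over finitely supported distributions\<close>

lemma expectation_bind:
  fixes h :: "'b \<Rightarrow> real"
  assumes "finite (set_pmf p)" "\<And>x. x \<in> set_pmf p \<Longrightarrow> finite (set_pmf (f x))"
  shows "measure_pmf.expectation (p \<bind> f) h =
    measure_pmf.expectation p (\<lambda>x. measure_pmf.expectation (f x) h)"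
  using assms by (subst pmf_expectation_bind[of "set_pmf p"], simp_all)
    (subst integral_measure_pmf[of "set_pmf p"], simp_all)

lemma expectation_mono:
  fixes f g :: "'a \<Rightarrow> real"
  assumes "finite (set_pmf p)" "\<And>x. x \<in> set_pmf p \<Longrightarrow> f x \<le> g x"
  shows "measure_pmf.expectation p f \<le> measure_pmf.expectation p g"
  using assms
  by (intro integral_mono_AE integrable_measure_pmf_finite) (simp_all add: AE_measure_pmf_iff)

lemma expectation_cong:
  fixes f g :: "'a \<Rightarrow> real"
  assumes "\<And>x. x \<in> set_pmf p \<Longrightarrow> f x = g x"
  shows "measure_pmf.expectation p f = measure_pmf.expectation p g"
  using assms by (intro integral_cong_AE) (simp_all add: AE_measure_pmf_iff)

section \<open>Offline schedules\<close>

lemma offline_arrivals_all: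
  assumes "offline_arrivals B Q ps A" "\<forall>j\<in>#Q. P j" "\<forall>p\<in>set ps. P \<lparr>pkt = p, served = 0\<rparr>"
  shows "\<forall>j\<in>#A. P j"
  using assms
proof (induction rule: offline_arrivals.induct)
  case (stop Q' Q)
  then show ?case by (meson mset_subset_eqD)
next
  case (arrive Q' p Q ps Q'')
  have "\<forall>j\<in>#Q'. P j"
    using arrive.prems mset_subset_eqD[OF arrive.hyps(1)] by auto
  with arrive show ?case by auto
qed

text \<open>Dropping packets only removes nonnegative summands. The weight \<open>f\<close> is
  general because it serves both as the class indicator and as the service spent on the class, which
  is 0 for a fresh packet.\<close>

lemma offline_arrivals_sum:
  fixes f :: "job \<Rightarrow> nat"
  assumes "offline_arrivals B Q ps A"
  shows "(\<Sum>j\<in>#A. f j) \<le> (\<Sum>j\<in>#Q. f j) + (\<Sum>p\<leftarrow>ps. f \<lparr>pkt = p, served = 0\<rparr>)"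
  using assms
proof (induction rule: offline_arrivals.induct)
  case (stop Q' Q)
  then show ?case by (auto dest!: subset_mset.le_imp_diff_is_add simp: mset_subset_eq_exists_conv)
next
  case (arrive Q' p Q ps Q'')
  have "(\<Sum>j\<in>#Q'. f j) \<le> (\<Sum>j\<in>#add_mset \<lparr>pkt = p, served = 0\<rparr> Q. f j)"
    using arrive.hyps(1) by (metis image_mset_subseteq_mono sum_mset.remove le_add1 mset_subset_eq_exists_conv sum_mset.union)
  with arrive show ?case by auto
qed

lemma offline_arrivals_size:
  "offline_arrivals B Q ps A \<Longrightarrow> size Q \<le> B \<Longrightarrow> size A \<le> B"
  by (induction rule: offline_arrivals.induct) (auto dest: size_mset_mono)

section \<open>Buffer operations of SA\<close>

lemma rank_le_2: "rank G j \<le> 2"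
  by (simp add: rank_def)

lemma rank_eq_2: "rank G j = 2 \<longleftrightarrow> \<not> admitted j \<and> \<not> GK G j"
  by (simp add: rank_def)

lemma lowest_rank_2:
  assumes "\<exists>j\<in>set q. rank G j = 2"
  shows "lowest G q < length q" "rank G (q ! lowest G q) = 2"
proof -
  obtain i where i: "i < length q" "rank G (q ! i) = 2"
    using assms by (metis in_set_conv_nth)
  let ?P = "\<lambda>i. i < length q \<and> (\<forall>k < length q. rank G (q ! k) \<le> rank G (q ! i))"
  have "?P i" using i rank_le_2 by auto
  then have *: "?P (lowest G q)"
    unfolding lowest_def by (rule GreatestI_nat[where b="length q"]) auto
  then show "lowest G q < length q" by simp
  show "rank G (q ! lowest G q) = 2"
    using * i rank_le_2[of G "q ! lowest G q"] by (metis le_antisym)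
qed

lemma highest_rank:
  assumes "q \<noteq> []"
  shows "highest G q < length q" "k < length q \<Longrightarrow> rank G (q ! highest G q) \<le> rank G (q ! k)"
proof -
  let ?P = "\<lambda>i. i < length q \<and> (\<forall>k < length q. rank G (q ! i) \<le> rank G (q ! k))"
  obtain i where "?P i"
    using ex_has_least_nat[of "\<lambda>i. i < length q" 0 "\<lambda>i. rank G (q ! i)"] assms by auto
  then have "?P (highest G q)" unfolding highest_def by (rule LeastI)
  then show "highest G q < length q" "k < length q \<Longrightarrow> rank G (q ! highest G q) \<le> rank G (q ! k)"
    by auto
qed

lemma ex_rank_2:
  assumes "num_GK G q + length (filter admitted q) < length q"
  shows "\<exists>j\<in>set q. rank G j = 2"
proof (rule ccontr)
  assume "\<not> ?thesis"
  then have "length q \<le> num_GK G q + length (filter admitted q)"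
    unfolding rank_eq_2 num_GK_def by (induction q) auto
  with assms show False by simp
qed

lemma filter_remove_nth:
  assumes "i < length q" "\<not> P (q ! i)"
  shows "filter P (take i q @ drop (Suc i) q) = filter P q"
  using assms by (subst (3) id_take_nth_drop[OF assms(1)]) simp

lemma make_room:
  assumes "length q \<le> B" "B \<ge> 1" "num_GK G q + length (filter admitted q) < B"
  shows "length (make_room B G q) \<le> B - 1"
    and "set (make_room B G q) \<subseteq> set q"
    and "(\<And>j. P j \<Longrightarrow> admitted j \<or> GK G j) \<Longrightarrow> filter P (make_room B G q) = filter P q"
proof -
  have *: "lowest G q < length q" "rank G (q ! lowest G q) = 2" if "length q = B"
    using lowest_rank_2[OF ex_rank_2[of G q]] assms that by auto
  show "length (make_room B G q) \<le> B - 1"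
    using * assms by (auto simp: make_room_def)
  show "set (make_room B G q) \<subseteq> set q"
    using set_take_subset[of "lowest G q" q] set_drop_subset[of "Suc (lowest G q)" q]
    by (auto simp: make_room_def)
  show "filter P (make_room B G q) = filter P q" if "\<And>j. P j \<Longrightarrow> admitted j \<or> GK G j"
    using * that filter_remove_nth[of "lowest G q" q P] by (auto simp: make_room_def rank_eq_2)
qed

lemma make_room_num_GK:
  assumes "length q \<le> B" "B \<ge> 1" "num_GK G q + length (filter admitted q) < B"
  shows "num_GK G (make_room B G q) = num_GK G q"
  using make_room(3)[OF assms, of "GK G"] by (simp add: num_GK_def)

lemma num_GK_accept:
  "num_GK G (accept p a q) = num_GK G q + of_bool (announced p \<and> p \<in> G)"
  by (auto simp: num_GK_def accept_def GK_def known_def)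

lemma filter_admitted_accept:
  "filter admitted (accept p a q) =
    filter admitted q @ (if a then [\<lparr>pkt = p, served = 0, admitted = True\<rparr>] else [])"
  by (simp add: accept_def)

section \<open>The processing step of SA\<close>

definition work_left :: "sa_buffer \<Rightarrow> nat" where
  "work_left q = (\<Sum>j\<leftarrow>q. work (pkt j) - served j)"

lemma sa_process_Nil [simp]: "sa_process G [] = []"
  by (simp add: sa_process_def)

lemma length_sa_process [simp]: "length (sa_process G q) = length q"
  by (simp add: sa_process_def)

text \<open>Turns the positional update into a split of the list, so that sums and filters over the
  buffer can be simplified.\<close>

lemma sa_process_split:
  assumes "q \<noteq> []"
  obtains xs j ys where "q = xs @ j # ys" "\<And>k. k \<in> set q \<Longrightarrow> rank G j \<le> rank G k"
    "sa_process G q = map (\<lambda>j. j\<lparr>admitted := False\<rparr>) (xs @ serve j # ys)"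
proof
  let ?i = "highest G q"
  note i = highest_rank[OF assms, where G=G]
  show "q = take ?i q @ q ! ?i # drop (Suc ?i) q"
    using i(1) by (rule id_take_nth_drop)
  show "rank G (q ! ?i) \<le> rank G k" if "k \<in> set q" for k
    using that i(2) by (auto simp: in_set_conv_nth)
  show "sa_process G q =
      map (\<lambda>j. j\<lparr>admitted := False\<rparr>) (take ?i q @ serve (q ! ?i) # drop (Suc ?i) q)"
    using i(1) assms by (simp add: sa_process_def upd_conv_take_nth_drop)
qed

lemma work_left_sa_process:
  assumes "q \<noteq> []" "\<forall>j\<in>set q. \<not> finished j"
  shows "Suc (work_left (sa_process G q)) = work_left q"
proof -
  obtain xs j ys where q: "q = xs @ j # ys"
    and p: "sa_process G q = map (\<lambda>j. j\<lparr>admitted := False\<rparr>) (xs @ serve j # ys)"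
    using sa_process_split[OF assms(1)] by metis
  have "served j < work (pkt j)" using assms q by (auto simp: finished_def)
  then show ?thesis unfolding p unfolding q by (simp add: work_left_def serve_def comp_def)
qed

lemma GK_unmark [simp]: "GK G (j\<lparr>admitted := x\<rparr>) = GK G j"
  by (simp add: GK_def known_def)

lemma GK_serve [simp]: "GK G (serve j) = (pkt j \<in> G)"
  by (simp add: GK_def known_def serve_def)

lemma sa_process_all:
  assumes "\<forall>j\<in>set q. P (pkt j)"
  shows "\<forall>j\<in>set (sa_process G q). \<not> admitted j \<and> P (pkt j)"
proof (cases "q = []")
  case False
  then obtain xs j ys where q: "q = xs @ j # ys"
    and p: "sa_process G q = map (\<lambda>j. j\<lparr>admitted := False\<rparr>) (xs @ serve j # ys)"
    by (rule sa_process_split)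
  show ?thesis using assms unfolding p unfolding q by (auto simp: serve_def)
qed simp

text \<open>The admitted packet has the highest priority, so it is the one whose characteristics are revealed.\<close>

lemma num_GK_sa_process:
  assumes "length (filter admitted q) \<le> 1" "\<forall>j\<in>set q. admitted j \<longrightarrow> \<not> known j"
  shows "num_GK G q + length (filter (\<lambda>j. admitted j \<and> pkt j \<in> G) q)
    \<le> num_GK G (sa_process G q)"
proof (cases "q = []")
  case True
  then show ?thesis by simp
next
  case False
  then obtain xs j ys where q: "q = xs @ j # ys"
    and r: "\<And>k. k \<in> set q \<Longrightarrow> rank G j \<le> rank G k"
    and p: "sa_process G q = map (\<lambda>j. j\<lparr>admitted := False\<rparr>) (xs @ serve j # ys)"
    using sa_process_split by blast
  have n: "num_GK G (sa_process G q) = num_GK G xs + of_bool (pkt j \<in> G) + num_GK G ys"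
    unfolding p num_GK_def filter_map by (simp add: comp_def)
  show ?thesis
  proof (cases "admitted j")
    case True
    then have "filter admitted xs = []" "filter admitted ys = []"
      using assms(1) q by auto
    then have "filter (\<lambda>j. admitted j \<and> pkt j \<in> G) xs = []"
        "filter (\<lambda>j. admitted j \<and> pkt j \<in> G) ys = []"
      by (auto simp: filter_empty_conv)
    moreover have "\<not> GK G j" using True assms q by (auto simp: GK_def)
    ultimately show ?thesis unfolding n unfolding q by (simp add: num_GK_def)
  next
    case False
    then have "filter (\<lambda>j. admitted j \<and> pkt j \<in> G) q = []"
      using r by (force simp: filter_empty_conv rank_def split: if_splits)
    moreover have "num_GK G q \<le> num_GK G xs + of_bool (pkt j \<in> G) + num_GK G ys"
      unfolding q by (auto simp: num_GK_def GK_def)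
    ultimately show ?thesis unfolding n by simp
  qed
qed

section \<open>The arrival step of SA\<close>

definition unfinished_buffer :: "nat \<Rightarrow> nat \<Rightarrow> sa_buffer \<Rightarrow> bool" where
  "unfinished_buffer B W q \<longleftrightarrow>
    length q \<le> B \<and> (\<forall>j\<in>set q. served j < work (pkt j) \<and> work (pkt j) \<le> W)"

definition admission :: "bool \<Rightarrow> nat \<Rightarrow> sa_buffer \<Rightarrow> bool" where
  "admission a m q \<longleftrightarrow>
    (if a \<and> 0 < m then \<exists>j. filter admitted q = [j] \<and> \<not> known j else filter admitted q = [])"

definition admitted_in :: "packet set \<Rightarrow> sa_buffer \<Rightarrow> real" where
  "admitted_in G q = real (length (filter (\<lambda>j. admitted j \<and> pkt j \<in> G) q))"

lemma admission_le: "admission a m q \<Longrightarrow> length (filter admitted q) \<le> 1"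
  by (auto simp: admission_def split: if_splits)

lemma admission_unknown:
  assumes "admission a m q" "j \<in> set q" "admitted j"
  shows "\<not> known j"
proof -
  have "j \<in> set (filter admitted q)" using assms by simp
  then show ?thesis using assms(1) by (auto simp: admission_def simp del: set_filter split: if_splits)
qed

lemma num_GK_drop_admitted:
  assumes "admission a m q"
  shows "num_GK G (drop_admitted q) = num_GK G q"
proof -
  have "filter (GK G) (drop_admitted q) = filter (GK G) q"
    unfolding drop_admitted_def filter_filter
    by (rule filter_cong) (use admission_unknown[OF assms] in \<open>auto simp: GK_def\<close>)
  then show ?thesis by (simp add: num_GK_def)
qed

lemma length_drop_admitted: "length (drop_admitted q) + length (filter admitted q) = length q"
  unfolding drop_admitted_def using sum_length_filter_compl[of admitted q] by simp

lemma filter_admitted_drop_admitted [simp]: "filter admitted (drop_admitted q) = []"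
  by (simp add: drop_admitted_def)

lemma unfinished_buffer_accept:
  assumes "unfinished_buffer B W q" "set q' \<subseteq> set q" "length q' < B" "work p \<in> {1..W}"
  shows "unfinished_buffer B W (accept p a q')"
  using assms by (auto simp: unfinished_buffer_def accept_def)

lemma sa_offer_step:
  assumes B: "B \<ge> 2" and q: "unfinished_buffer B W q" "admission a m q" "num_GK G q < B"
    and p: "work p \<in> {1..W}" and m': "m' = (if announced p then m else Suc m)"
    and q': "q' \<in> set_pmf (sa_offer B G a m' p q)"
  shows "unfinished_buffer B W q'"
    and "num_GK G q' = num_GK G q + of_bool (announced p \<and> p \<in> G)"
    and "num_GK G q' < B \<Longrightarrow> admission a m' q'"
    and "num_GK G q' < B \<Longrightarrow> announced p \<Longrightarrow> admitted_in G q' = admitted_in G q"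
proof -
  note acc = unfinished_buffer_accept[OF q(1) _ _ p]
  have len: "length q \<le> B" using q(1) by (simp add: unfinished_buffer_def)
  consider (known) "announced p" "p \<in> G" | (first) "\<not> announced p" "a" "m = 0"
    | (replace) "\<not> announced p" "a" "m > 0" "q' = accept p True (drop_admitted q)"
    | (other) "\<not> (announced p \<and> p \<in> G)" "announced p \<or> \<not> a \<or> m > 0"
        "q' = (if length q < B then accept p False q else q)"
    using q' m' by (auto simp: sa_offer_def Let_def split: if_splits)
  then have *: "unfinished_buffer B W q'
    \<and> num_GK G q' = num_GK G q + of_bool (announced p \<and> p \<in> G)
    \<and> (num_GK G q' < B \<longrightarrow> admission a m' q')
    \<and> (num_GK G q' < B \<longrightarrow> announced p \<longrightarrow> admitted_in G q' = admitted_in G q)"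
  proof cases
    case known
    define q0 where "q0 = (if num_GK G q = B - 1 then drop_admitted q else q)"
    have q'eq: "q' = accept p False (make_room B G q0)"
      using q' known by (simp add: sa_offer_def q0_def)
    have GK0: "num_GK G q0 = num_GK G q"
      using num_GK_drop_admitted[OF q(2)] by (simp add: q0_def)
    have len0: "length q0 \<le> B"
      using len length_drop_admitted[of q] by (auto simp: q0_def)
    have "num_GK G q0 + length (filter admitted q0) < B"
      unfolding GK0 using q(3) admission_le[OF q(2)] by (auto simp: q0_def)
    note mr = make_room[OF len0 _ this] make_room_num_GK[OF len0 _ this]
    have "set q0 \<subseteq> set q" by (auto simp: q0_def drop_admitted_def)
    then have 1: "unfinished_buffer B W q'"
      unfolding q'eq using mr(1,2) B by (intro acc) auto
    have 2: "num_GK G q' = Suc (num_GK G q)"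
      unfolding q'eq num_GK_accept using mr(4) GK0 B known by simp
    have 3: "admission a m' q' \<and> admitted_in G q' = admitted_in G q" if "num_GK G q' < B"
    proof -
      have "num_GK G q \<noteq> B - 1" using that 2 by simp
      then have q0: "q0 = q" by (simp add: q0_def)
      have "filter admitted q' = filter admitted q"
        unfolding q'eq filter_admitted_accept using mr(3)[of admitted] B q0 by simp
      moreover have "filter (\<lambda>j. admitted j \<and> pkt j \<in> G) q'
          = filter (\<lambda>j. admitted j \<and> pkt j \<in> G) q"
        unfolding q'eq using mr(3)[of "\<lambda>j. admitted j \<and> pkt j \<in> G"] B q0 by (simp add: accept_def)
      ultimately show ?thesis
        using q(2) m' known by (simp add: admission_def admitted_in_def)
    qed
    show ?thesis using 1 2 3 known by simp
  next
    case first
    have q'eq: "q' = accept p True (make_room B G q)"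
      using q' first m' by (simp add: sa_offer_def)
    have f: "filter admitted q = []" using q(2) first by (simp add: admission_def)
    then have "num_GK G q + length (filter admitted q) < B" using q(3) by simp
    note mr = make_room[OF len _ this] make_room_num_GK[OF len _ this]
    show ?thesis
      using mr(1,2) mr(3)[of admitted] mr(4) B first f m'
      by (auto simp: q'eq admission_def num_GK_accept filter_admitted_accept known_def intro!: acc)
  next
    case replace
    have "length (drop_admitted q) < B"
      using length_drop_admitted[of q] len q(2) replace by (auto simp: admission_def)
    then have 1: "unfinished_buffer B W q'"
      unfolding replace(4) by (intro acc) (auto simp: drop_admitted_def)
    show ?thesis
      using replace m' num_GK_drop_admitted[OF q(2), of G] 1
      by (auto simp: admission_def num_GK_accept filter_admitted_accept known_def)
  next
    case other
    have 1: "unfinished_buffer B W q'"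
      unfolding other(3) using q(1) by (auto intro: acc)
    have f: "filter admitted q' = filter admitted q"
      by (simp add: other(3) filter_admitted_accept)
    have "filter (\<lambda>j. admitted j \<and> pkt j \<in> G) q' = filter (\<lambda>j. admitted j \<and> pkt j \<in> G) q"
      by (simp add: other(3) accept_def)
    then show ?thesis
      using 1 q(2) other(1,2) m' num_GK_accept[of G p False q] unfolding admission_def f
      by (auto simp: other(3) admitted_in_def)
  qed
  then show "unfinished_buffer B W q'"
    and "num_GK G q' = num_GK G q + of_bool (announced p \<and> p \<in> G)"
    and "num_GK G q' < B \<Longrightarrow> admission a m' q'"
    and "num_GK G q' < B \<Longrightarrow> announced p \<Longrightarrow> admitted_in G q' = admitted_in G q"
    by auto
qed

lemma finite_set_pmf_sa_offer: "finite (set_pmf (sa_offer B G a m p q))"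
  by (simp add: sa_offer_def Let_def)

lemma finite_set_pmf_sa_arrivals: "finite (set_pmf (sa_arrivals B G a m ps (ph, q)))"
  by (induction ps arbitrary: m ph q) (auto simp: Let_def finite_set_pmf_sa_offer)

lemma sa_arrivals_Flush [simp]: "sa_arrivals B G a m ps (Flush, q) = return_pmf (Flush, q)"
  by (cases ps) simp_all

lemma update_phase_Fill:
  "B \<ge> 1 \<Longrightarrow> update_phase B G q Fill = (if num_GK G q = B then Flush else Fill)"
  by (auto simp: update_phase_def num_GK_def)

definition count_known :: "packet set \<Rightarrow> packet list \<Rightarrow> nat" where
  "count_known G ps = length (filter (\<lambda>p. announced p \<and> p \<in> G) ps)"

definition count_unknown :: "packet set \<Rightarrow> packet list \<Rightarrow> nat" where
  "count_unknown G ps = length (filter (\<lambda>p. \<not> announced p \<and> p \<in> G) ps)"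

lemma sa_arrivals_result:
  assumes "B \<ge> 2" "unfinished_buffer B W q" "admission a m q" "num_GK G q < B"
    and "\<forall>p\<in>set ps. work p \<in> {1..W}" "(ph', q') \<in> set_pmf (sa_arrivals B G a m ps (Fill, q))"
  shows "unfinished_buffer B W q'
    \<and> (if num_GK G q + count_known G ps < B
       then ph' = Fill \<and> num_GK G q' = num_GK G q + count_known G ps
         \<and> (\<exists>m'. admission a m' q')
       else ph' = Flush \<and> num_GK G q' = B)"
  using assms(2-)
proof (induction ps arbitrary: m q)
  case Nil
  then show ?case by (auto simp: count_known_def)
next
  case (Cons p ps)
  define m' where "m' = (if announced p then m else Suc m)"
  obtain q1 where q1: "q1 \<in> set_pmf (sa_offer B G a m' p q)"
    and res: "(ph', q') \<in> set_pmf (sa_arrivals B G a m' ps (update_phase B G q1 Fill, q1))"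
    using Cons.prems(5) by (auto simp: Let_def m'_def split: if_splits)
  have "work p \<in> {1..W}" using Cons.prems(4) by simp
  note s = sa_offer_step[OF assms(1) Cons.prems(1-3) this m'_def q1]
  have le: "num_GK G q1 \<le> B" using s(2) Cons.prems(3) by (simp add: of_bool_def)
  have ck: "num_GK G q + count_known G (p # ps) = num_GK G q1 + count_known G ps"
    by (simp add: s(2) count_known_def)
  show ?case
  proof (cases "num_GK G q1 = B")
    \<comment> \<open>The phase is now \<open>Flush\<close>, which ignores the remaining
      \<open>ps\<close>; by \<open>ck\<close> the total is at least \<open>B\<close>.\<close>
    case True
    then show ?thesis
      using res s(1) assms(1) ck by (simp add: update_phase_Fill)
  next
    case False
    then have "num_GK G q1 < B" using le by simp
    moreover have "(ph', q') \<in> set_pmf (sa_arrivals B G a m' ps (Fill, q1))"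
      using res False assms(1) by (simp add: update_phase_Fill)
    ultimately show ?thesis
      unfolding ck using Cons.prems(4) s by (intro Cons.IH) auto
  qed
qed

text \<open>The replacement probabilities implement reservoir sampling: each of the U-packets offered so
  far is equally likely to be the admitted one.\<close>

lemma sa_offer_expectation:
  assumes B: "B \<ge> 2" and q: "unfinished_buffer B W q" "admission True m q" "num_GK G q < B"
    and p: "work p \<in> {1..W}" and m': "m' = (if announced p then m else Suc m)"
    and G: "num_GK G q + of_bool (announced p \<and> p \<in> G) < B"
  shows "measure_pmf.expectation (sa_offer B G True m' p q) (\<lambda>q'. real m' * admitted_in G q')
    = real m * admitted_in G q + of_bool (\<not> announced p \<and> p \<in> G)"
proof (cases "announced p")
  case True
  have "measure_pmf.expectation (sa_offer B G True m' p q) (\<lambda>q'. real m' * admitted_in G q')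
    = measure_pmf.expectation (sa_offer B G True m' p q) (\<lambda>q'. real m * admitted_in G q)"
    using sa_offer_step(2,4)[OF B q p m'] G True m' by (intro expectation_cong) auto
  then show ?thesis using True by simp
next
  case False
  have "admitted_in G (accept p True x) = of_bool (p \<in> G)" if "filter admitted x = []" for x
  proof -
    have "filter (\<lambda>j. admitted j \<and> pkt j \<in> G) x = []"
      using that by (auto simp: filter_empty_conv)
    then show ?thesis by (simp add: admitted_in_def accept_def)
  qed
  note acc = this
  show ?thesis
  proof (cases "m = 0")
    case True
    have f: "filter admitted q = []" using q(2) True by (simp add: admission_def)
    have "filter admitted (make_room B G q) = []"
      using make_room(3)[of q B G admitted] q B f by (simp add: unfinished_buffer_def)
    then show ?thesis
      using True False m' by (simp add: sa_offer_def acc)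
  next
    case m: False
    define q0 where "q0 = (if length q < B then accept p False q else q)"
    define q1 where "q1 = accept p True (drop_admitted q)"
    have "admitted_in G q0 = admitted_in G q"
      by (simp add: q0_def admitted_in_def accept_def)
    moreover have "admitted_in G q1 = of_bool (p \<in> G)"
      unfolding q1_def by (rule acc) simp
    moreover have "sa_offer B G True m' p q =
        bernoulli_pmf (1 / real m') \<bind> (\<lambda>b. return_pmf (if b then q1 else q0))"
      using m False m' unfolding q0_def q1_def sa_offer_def Let_def
      by (auto intro!: bind_pmf_cong)
    \<comment> \<open>With \<open>m' = m + 1\<close>, the new packet is chosen with probability
      \<open>1 / m'\<close> and the old one kept with probability \<open>m / m'\<close>; multiplying
      by \<open>m'\<close> clears the denominators.\<close>
    ultimately show ?thesis
      using False m' by (simp add: expectation_bind distrib_left right_diff_distrib flip: mult.assoc)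
        (simp add: field_simps)
  qed
qed

lemma sa_arrivals_expectation:
  assumes "B \<ge> 2" "unfinished_buffer B W q" "admission True m q"
    and "num_GK G q + count_known G ps < B" "\<forall>p\<in>set ps. work p \<in> {1..W}"
  shows "real (m + length (filter (\<lambda>p. \<not> announced p) ps))
      * measure_pmf.expectation (sa_arrivals B G True m ps (Fill, q)) (\<lambda>(ph, q'). admitted_in G q')
    = real m * admitted_in G q + real (count_unknown G ps)"
  using assms(2-)
proof (induction ps arbitrary: m q)
  case Nil
  then show ?case by (simp add: count_unknown_def)
next
  case (Cons p ps)
  define m' where "m' = (if announced p then m else Suc m)"
  let ?E = "\<lambda>q1. measure_pmf.expectation (sa_arrivals B G True m' ps (Fill, q1))
    (\<lambda>(ph, q'). admitted_in G q')"
  let ?n = "real (m' + length (filter (\<lambda>p. \<not> announced p) ps))"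
  let ?o = "sa_offer B G True m' p q"
  have fin: "finite (set_pmf ?o)" by (rule finite_set_pmf_sa_offer)
  have lt: "num_GK G q < B" "num_GK G q + of_bool (announced p \<and> p \<in> G) < B"
    using Cons.prems(3) by (auto simp: count_known_def of_bool_def split: if_splits)
  have p: "work p \<in> {1..W}" using Cons.prems(4) by simp
  have q1: "update_phase B G q1 Fill = Fill"
    "?n * ?E q1 = real m' * admitted_in G q1 + real (count_unknown G ps)"
    if "q1 \<in> set_pmf ?o" for q1
  proof -
    note s = sa_offer_step[OF assms(1) Cons.prems(1,2) lt(1) p m'_def that]
    have "num_GK G q1 + count_known G ps < B"
      using Cons.prems(3) s(2) by (auto simp: count_known_def of_bool_def split: if_splits)
    then show "update_phase B G q1 Fill = Fill"
      using assms(1) by (simp add: update_phase_Fill)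
    show "?n * ?E q1 = real m' * admitted_in G q1 + real (count_unknown G ps)"
      using \<open>num_GK G q1 + count_known G ps < B\<close> s Cons.prems(4) by (intro Cons.IH) auto
  qed
  \<comment> \<open>The factor \<open>?n\<close> counts the U-packets already offered and those to
    come, so it is constant along the induction.\<close>
  have n: "real (m + length (filter (\<lambda>p. \<not> announced p) (p # ps))) = ?n"
    by (simp add: m'_def)
  have "measure_pmf.expectation (sa_arrivals B G True m (p # ps) (Fill, q))
      (\<lambda>(ph, q'). admitted_in G q') = measure_pmf.expectation ?o ?E"
    using q1(1)
    by (auto simp: Let_def m'_def[symmetric] expectation_bind fin finite_set_pmf_sa_arrivals
        intro!: expectation_cong)
  then have "?n * measure_pmf.expectation (sa_arrivals B G True m (p # ps) (Fill, q))
      (\<lambda>(ph, q'). admitted_in G q') = measure_pmf.expectation ?o (\<lambda>q1. ?n * ?E q1)"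
    by simp
  also have "\<dots> = measure_pmf.expectation ?o
      (\<lambda>q1. real m' * admitted_in G q1 + real (count_unknown G ps))"
    by (intro expectation_cong q1(2))
  also have "\<dots> = measure_pmf.expectation ?o (\<lambda>q1. real m' * admitted_in G q1)
      + real (count_unknown G ps)"
    by (subst Bochner_Integration.integral_add)
      (auto simp: integrable_measure_pmf_finite fin simp del: integral_mult_right_zero)
  also have "\<dots> = real m * admitted_in G q + of_bool (\<not> announced p \<and> p \<in> G)
      + real (count_unknown G ps)"
    by (subst sa_offer_expectation[OF assms(1) Cons.prems(1,2) lt(1) p m'_def lt(2)]) simp
  finally show ?case unfolding n by (simp add: count_unknown_def)
qed

lemma num_GK_le_length: "num_GK G q \<le> length q"
  by (simp add: num_GK_def)

lemma num_GK_eq_length: "num_GK G q = length q \<longleftrightarrow> (\<forall>j\<in>set q. GK G j)"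
  unfolding num_GK_def by (metis filter_id_conv length_filter_less less_irrefl)

lemma num_GK_sa_process_mono: "num_GK G q \<le> num_GK G (sa_process G q)"
proof (cases "q = []")
  case False
  then obtain xs j ys where q: "q = xs @ j # ys"
    and p: "sa_process G q = map (\<lambda>j. j\<lparr>admitted := False\<rparr>) (xs @ serve j # ys)"
    by (rule sa_process_split)
  show ?thesis
    unfolding p unfolding q num_GK_def filter_map by (auto simp: comp_def) (simp add: GK_def)
qed simp

lemma num_GK_filter:
  "num_GK G q = num_GK G (filter (\<lambda>j. \<not> P j) q) + num_GK G (filter P q)"
  by (induction q) (auto simp: num_GK_def)

text \<open>Truncated subtraction makes finished packets contribute 0.\<close>

lemma work_left_unfinished: "work_left (filter (\<lambda>j. \<not> finished j) q) = work_left q"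
  by (induction q) (auto simp: work_left_def finished_def)

section \<open>The potential function\<close>

definition class_jobs :: "packet set \<Rightarrow> job multiset \<Rightarrow> nat" where
  "class_jobs G Q = (\<Sum>j\<in>#Q. of_bool (pkt j \<in> G))"

text \<open>Processing that the offline algorithm has invested in buffered class packets. It grows
  by at most 1 per cycle, and each transmitted class packet uses up at least the minimal work of the
  class; this limits the offline transmissions during phase \<open>Flush\<close>.\<close>

definition class_service :: "packet set \<Rightarrow> job multiset \<Rightarrow> nat" where
  "class_service G Q = (\<Sum>j\<in>#Q. if pkt j \<in> G then served j else 0)"

lemma class_jobs_le_size: "class_jobs G Q \<le> size Q"
  by (induction Q) (auto simp: class_jobs_def)

lemma class_jobs_filter:
  "class_jobs G Q = class_jobs G (filter_mset P Q) + class_jobs G (filter_mset (\<lambda>j. \<not> P j) Q)"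
  by (induction Q) (auto simp: class_jobs_def)

lemma class_jobs_arrivals:
  assumes "offline_arrivals B Q ps A"
  shows "class_jobs G A \<le> class_jobs G Q + count_known G ps + count_unknown G ps"
proof -
  have "(\<Sum>p\<leftarrow>ps. of_bool (pkt \<lparr>pkt = p, served = 0\<rparr> \<in> G)) = count_known G ps + count_unknown G ps"
    by (induction ps) (auto simp: count_known_def count_unknown_def)
  then show ?thesis
    using offline_arrivals_sum[OF assms, of "\<lambda>j. of_bool (pkt j \<in> G)"] by (simp add: class_jobs_def)
qed

lemma class_service_arrivals:
  assumes "offline_arrivals B Q ps A"
  shows "class_service G A \<le> class_service G Q"
  using offline_arrivals_sum[OF assms, of "\<lambda>j. if pkt j \<in> G then served j else 0"]
  by (simp add: class_service_def cong: if_cong)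

lemma sum_mset_serve:
  fixes f :: "job \<Rightarrow> nat"
  assumes "offline_process A Q" "\<And>j. f (serve j) \<le> f j + d"
  shows "(\<Sum>j\<in>#Q. f j) \<le> (\<Sum>j\<in>#A. f j) + d"
  using assms(1) unfolding offline_process_def
proof (elim disjE bexE)
  fix j assume j: "j \<in># A" "Q = add_mset (serve j) (A - {#j#})"
  then obtain A' where "A = add_mset j A'" by (metis insert_DiffM)
  with j(2) assms(2)[of j] show ?thesis by simp
qed simp

text \<open>Two predicates, because a processing cycle may weaken the property, as from
  \<open>served j < work (pkt j)\<close> to \<open>served j \<le> work (pkt j)\<close>.\<close>

lemma offline_process_all:
  assumes "offline_process A Q" "\<forall>j\<in>#A. P j"
    and "\<And>j. P j \<Longrightarrow> P' j" "\<And>j. P j \<Longrightarrow> P' (serve j)"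
  shows "\<forall>j\<in>#Q. P' j"
proof
  fix k assume "k \<in># Q"
  then have "k \<in># A \<or> (\<exists>j\<in>#A. k = serve j)"
    using assms(1) by (auto simp: offline_process_def dest: in_diffD)
  then show "P' k" using assms(2-4) by blast
qed

lemma class_jobs_process: "offline_process A Q \<Longrightarrow> class_jobs G Q \<le> class_jobs G A"
  using sum_mset_serve[of A Q "\<lambda>j. of_bool (pkt j \<in> G)" 0] by (simp add: class_jobs_def serve_def)

lemma class_service_process: "offline_process A Q \<Longrightarrow> class_service G Q \<le> class_service G A + 1"
  using sum_mset_serve[of A Q "\<lambda>j. if pkt j \<in> G then served j else 0" 1]
  by (simp add: class_service_def serve_def)

text \<open>At the beginning of a cycle a packet may be finished but never overserved, since
  finished packets leave before the next processing step.\<close>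

definition offline_buffer :: "nat \<Rightarrow> job multiset \<Rightarrow> bool" where
  "offline_buffer B Q \<longleftrightarrow> size Q \<le> B \<and> (\<forall>j\<in>#Q. served j \<le> work (pkt j))"

lemma offline_buffer_step:
  assumes "offline_buffer B Q" "\<forall>p\<in>set ps. work p \<ge> 1"
    and A: "offline_arrivals B (filter_mset (\<lambda>j. \<not> finished j) Q) ps A" "offline_process A Q'"
  shows "offline_buffer B Q'"
proof -
  have "size A \<le> B"
    using assms(1) by (intro offline_arrivals_size[OF A(1)])
      (auto simp: offline_buffer_def intro: order_trans[OF size_filter_mset_lesseq])
  moreover have "\<forall>j\<in>#A. served j < work (pkt j)"
    using assms(2) by (intro offline_arrivals_all[OF A(1)]) (auto simp: finished_def)
  moreover have "size Q' = size A"
    using A(2) by (auto simp: offline_process_def dest!: multi_member_split)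
  ultimately show ?thesis
    using offline_process_all[OF A(2), of "\<lambda>j. served j < work (pkt j)" "\<lambda>j. served j \<le> work (pkt j)"]
    by (auto simp: offline_buffer_def serve_def)
qed

section \<open>State invariant and decomposition of a cycle of SA\<close>

text \<open>It refers to cycle boundaries. Phase \<open>Flush\<close> starts with \<open>B\<close>
  known class packets and accepts nothing, so until it ends the buffer consists of known class
  packets only.\<close>

definition sa_inv :: "nat \<Rightarrow> nat \<Rightarrow> packet set \<Rightarrow> sa_state \<Rightarrow> bool" where
  "sa_inv B W G s \<longleftrightarrow>
    length (buffer s) \<le> B \<and> (\<forall>j\<in>set (buffer s). \<not> admitted j \<and> work (pkt j) \<le> W) \<and>
    (if phase s = Fill then num_GK G (buffer s) < B else num_GK G (buffer s) = length (buffer s))"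

definition sa_finish :: "nat \<Rightarrow> packet set \<Rightarrow> nat \<Rightarrow> phase \<times> sa_buffer \<Rightarrow> sa_state" where
  "sa_finish B G g x = \<lparr>phase = update_phase B G (sa_process G (snd x)) (fst x),
    buffer = sa_process G (snd x), gain = g\<rparr>"

lemma sa_cycle_eq:
  fixes B G r s
  defines "q \<equiv> filter (\<lambda>j. \<not> finished j) (buffer s)"
  shows "sa_cycle B G r ps s =
    bernoulli_pmf r \<bind> (\<lambda>a. sa_arrivals B G a 0 ps (update_phase B G q (phase s), q)) \<bind>
      (\<lambda>x. return_pmf (sa_finish B G
        (gain s + (\<Sum>j\<leftarrow>filter finished (buffer s). profit (pkt j))) x))"
  by (simp add: sa_cycle_def Let_def q_def sa_finish_def case_prod_unfold bind_assoc_pmf)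

lemma finite_set_pmf_sa_run: "finite (set_pmf (sa_run B G r \<sigma> n))"
  by (induction n) (auto simp: sa_cycle_eq finite_set_pmf_sa_arrivals)

section \<open>Analysis of one fixed class\<close>

text \<open>SA earns at least \<open>b\<close> per class packet. The offline packets are merely
  counted here and receive the weight \<open>2 * b\<close> in the summation over the
  classes.\<close>

locale sa_class =
  fixes B M W c b :: nat and r :: real and G :: "packet set"
  assumes B: "B \<ge> 2" and M: "M \<ge> 1" and r: "0 < r" "r \<le> 1" and c: "c \<ge> 1" and b: "b \<ge> 1"
    and work_G: "p \<in> G \<Longrightarrow> work p \<in> {c..2 * c}" and profit_G: "p \<in> G \<Longrightarrow> b \<le> profit p"
begin

text \<open>The exchange rate between unknown and known packets: in a cycle of phase
  \<open>Fill\<close> without overflow, \<open>x\<close> unknown class packets lead in expectation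
  to at least \<open>x / rate\<close> revealed ones.\<close>

definition rate :: real where "rate = real M / r"

lemma rate_ge_1: "rate \<ge> 1"
  using M r by (simp add: rate_def field_simps)

text \<open>\<open>T\<close> counts the packets of the class that the offline algorithm has transmitted. In phase
  \<open>Fill\<close> each known buffered packet of the class holds back a credit of 5. At the beginning of
  phase \<open>Flush\<close> there are \<open>B\<close> of them, and their credits pay for the at most \<open>4 B\<close> packets that
  the offline algorithm transmits during that phase and the \<open>B\<close> packets in its buffer afterwards.\<close>

definition potential :: "nat \<Rightarrow> job multiset \<Rightarrow> sa_state \<Rightarrow> real" where
  "potential T Q s = real T - (rate + 5) * (real (gain s) / real b) +
    (case phase s of
       Fill \<Rightarrow> real (class_jobs G Q) - rate * real (num_GK G (buffer s))
     | Flush \<Rightarrow> real B + real (class_service G Q + work_left (buffer s)) / real c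
         - (rate + 5) * real (num_GK G (buffer s)))"

text \<open>A finished class packet has received at least its work, which is at least
  \<open>c\<close>.\<close>

lemma class_service_filter:
  "c * class_jobs G (filter_mset finished Q) + class_service G (filter_mset (\<lambda>j. \<not> finished j) Q)
    \<le> class_service G Q"
  by (induction Q) (auto simp: class_jobs_def class_service_def finished_def dest: work_G)

lemma class_service_le:
  assumes "offline_buffer B Q"
  shows "class_service G Q \<le> 2 * c * B"
proof -
  have "\<forall>j\<in>#Q. (if pkt j \<in> G then served j else 0) \<le> 2 * c"
    using assms by (fastforce simp: offline_buffer_def dest: work_G)
  then have "class_service G Q \<le> 2 * c * size Q"
    unfolding class_service_def by (induction Q) auto
  also have "\<dots> \<le> 2 * c * B"
    using assms by (simp add: offline_buffer_def)
  finally show ?thesis .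
qed

lemma work_left_le:
  assumes "\<forall>j\<in>set q. work (pkt j) \<le> w" "length q \<le> n"
  shows "work_left q \<le> w * n"
proof -
  have "work_left q \<le> w * length q"
    using assms(1) unfolding work_left_def by (induction q) auto
  then show ?thesis using assms(2) by (meson mult_le_mono2 order_trans)
qed

lemma profit_filter_GK:
  "b * num_GK G q \<le> (\<Sum>j\<leftarrow>q. profit (pkt j))"
  by (induction q) (auto simp: num_GK_def GK_def dest!: profit_G)

text \<open>Each known class packet sent by SA earns at least \<open>b\<close>, so the gain term
  pays \<open>rate + 5\<close>, no less than the weight of the packet in either phase. Offline
  transmissions move from \<open>class_jobs\<close> to \<open>T\<close> in phase
  \<open>Fill\<close>, and each is paid by \<open>c\<close> units of \<open>class_service\<close>
  while phase \<open>Flush\<close> lasts.\<close>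

lemma potential_transmit:
  assumes "sa_inv B W G s" "offline_buffer B Q" "q = filter (\<lambda>j. \<not> finished j) (buffer s)"
  shows "potential (T + class_jobs G (filter_mset finished Q)) (filter_mset (\<lambda>j. \<not> finished j) Q)
      \<lparr>phase = update_phase B G q (phase s), buffer = q,
        gain = gain s + (\<Sum>j\<leftarrow>filter finished (buffer s). profit (pkt j))\<rparr>
    \<le> potential T Q s"
proof -
  define sent where "sent = filter finished (buffer s)"
  define P where "P = (\<Sum>j\<leftarrow>sent. profit (pkt j))"
  let ?F = "filter_mset finished Q" and ?U = "filter_mset (\<lambda>j. \<not> finished j) Q"
  have n: "num_GK G (buffer s) = num_GK G q + num_GK G sent"
    unfolding assms(3) sent_def by (rule num_GK_filter)
  have "real b * real (num_GK G sent) \<le> real P"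
    using profit_filter_GK[of sent] unfolding P_def by (metis of_nat_le_iff of_nat_mult)
  then have "real (num_GK G sent) \<le> real P / real b"
    using b by (simp add: field_simps)
  then have P: "(rate + 5) * real (num_GK G sent) \<le> (rate + 5) * (real P / real b)"
    using rate_ge_1 by (intro mult_left_mono) auto
  have gain: "(rate + 5) * (real (gain s + P) / real b)
      = (rate + 5) * (real (gain s) / real b) + (rate + 5) * (real P / real b)"
    by (simp add: add_divide_distrib distrib_left)
  have jobs: "class_jobs G Q = class_jobs G ?F + class_jobs G ?U"
    by (rule class_jobs_filter)
  show ?thesis
  proof (cases "phase s")
    case Fill
    have "num_GK G q < B"
      using assms(1) Fill n by (simp add: sa_inv_def)
    then have "update_phase B G q Fill = Fill"
      by (simp add: update_phase_def)
    then show ?thesis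
      using P Fill unfolding potential_def sent_def[symmetric] P_def[symmetric]
      by (simp add: n jobs add_divide_distrib distrib_left distrib_right)
  next
    case Flush
    have all: "num_GK G (buffer s) = length (buffer s)"
      using assms(1) Flush by (simp add: sa_inv_def)
    have wl: "work_left q = work_left (buffer s)"
      unfolding assms(3) by (rule work_left_unfinished)
    show ?thesis
    proof (cases "q = []")
      \<comment> \<open>Phase \<open>Flush\<close> ends here. Its reserve \<open>B\<close> covers
        all class packets held by the offline algorithm, those sent now and those that
        remain.\<close>
      case True
      then have "update_phase B G q Flush = Fill" by (simp add: update_phase_def)
      moreover have "real (class_jobs G Q) \<le> real B"
        using class_jobs_le_size[of G Q] assms(2) by (simp add: offline_buffer_def)
      moreover define Z where "Z = real (class_service G Q + work_left (buffer s)) / real c"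
      then have "Z \<ge> 0" by simp
      ultimately show ?thesis
        using P Flush True n
        unfolding potential_def sent_def[symmetric] P_def[symmetric] Z_def[symmetric]
        by (simp add: num_GK_def jobs add_divide_distrib distrib_left)
    next
      case False
      then have ph: "update_phase B G q Flush = Flush" by (simp add: update_phase_def)
      have "real (c * class_jobs G ?F + class_service G ?U) \<le> real (class_service G Q)"
        using class_service_filter[of Q] by (simp only: of_nat_le_iff)
      then have "(real c * real (class_jobs G ?F) + real (class_service G ?U + work_left q)) / real c
          \<le> real (class_service G Q + work_left q) / real c"
        by (intro divide_right_mono) simp_all
      then have "real (class_jobs G ?F) + real (class_service G ?U + work_left q) / real c
          \<le> real (class_service G Q + work_left q) / real c"
        using c by (simp add: add_divide_distrib)
      then show ?thesis
        using P Flush n unfolding potential_def sent_def[symmetric] P_def[symmetric] gain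
        by (simp add: ph wl distrib_left add_divide_distrib)
    qed
  qed
qed

text \<open>The source of the constant 5: for a Gfull buffer the offline service and the remaining
  work of SA are at most \<open>2 * c * B\<close> each. Divided by \<open>c\<close> and added to the
  reserve \<open>B\<close> they give at most \<open>5 * B\<close>, which cancels against the extra
  weight 5 of the \<open>B\<close> known class packets.\<close>

lemma potential_le:
  assumes "offline_buffer B Q" "length (buffer s) \<le> B"
    and "phase s = (if num_GK G (buffer s) = B then Flush else Fill)"
  shows "potential T Q s \<le> real T - (rate + 5) * (real (gain s) / real b)
    + (if num_GK G (buffer s) = B then 0 else real (class_jobs G Q)) - rate * num_GK G (buffer s)"
proof (cases "num_GK G (buffer s) = B")
  case True
  then have "\<forall>j\<in>set (buffer s). GK G j"
    using assms(2) num_GK_le_length[of G "buffer s"] num_GK_eq_length[of G "buffer s"] by simp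
  then have "work_left (buffer s) \<le> 2 * c * B"
    using assms(2) by (intro work_left_le) (auto simp: GK_def dest!: work_G bspec)
  then have "class_service G Q + work_left (buffer s) \<le> 4 * B * c"
    using class_service_le[OF assms(1)] by (simp add: algebra_simps)
  then have "real (class_service G Q + work_left (buffer s)) \<le> real (4 * B * c)"
    by (simp only: of_nat_le_iff)
  then have "real (class_service G Q + work_left (buffer s)) / real c \<le> 4 * real B"
    using c by (simp add: field_simps)
  then show ?thesis
    using True assms(3) by (simp add: potential_def distrib_right)
next
  case False
  then show ?thesis using assms(3) by (simp add: potential_def)
qed

text \<open>Processing keeps a Gfull buffer Gfull, but it may also reveal the \<open>B\<close>-th
  class packet, so phase \<open>Flush\<close> can start here.\<close>

lemma sa_finish_phase:
  assumes "length q \<le> B" "if ph = Fill then num_GK G q < B else num_GK G q = B"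
  shows "length (buffer (sa_finish B G g (ph, q))) \<le> B"
    and "phase (sa_finish B G g (ph, q)) =
      (if num_GK G (buffer (sa_finish B G g (ph, q))) = B then Flush else Fill)"
proof -
  let ?q = "sa_process G q"
  show 1: "length (buffer (sa_finish B G g (ph, q))) \<le> B"
    using assms(1) by (simp add: sa_finish_def)
  then show "phase (sa_finish B G g (ph, q)) =
      (if num_GK G (buffer (sa_finish B G g (ph, q))) = B then Flush else Fill)"
    using assms(2) num_GK_sa_process_mono[of G q] num_GK_le_length[of G ?q] B
    by (cases ph) (auto simp: sa_finish_def update_phase_def num_GK_def)
qed

text \<open>In case of overflow, \<open>potential_le\<close> bounds every outcome independently of
  the offline buffer. Otherwise the offline buffer gains at most the arriving class packets: the
  known ones are matched at weight \<open>rate \<ge> 1\<close>, the unknown ones by the expected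
  number that SA reveals.\<close>

lemma potential_Fill:
  assumes q: "unfinished_buffer B W q" "filter admitted q = []" "num_GK G q < B"
    and ps: "\<forall>p\<in>set ps. work p \<in> {1..W}" "length (filter (\<lambda>p. \<not> announced p) ps) \<le> M"
    and Q: "offline_arrivals B Q ps A" "offline_process A Q'" "offline_buffer B Q'"
  shows "measure_pmf.expectation (bernoulli_pmf r \<bind> (\<lambda>a. sa_arrivals B G a 0 ps (Fill, q)))
      (\<lambda>x. potential T Q' (sa_finish B G g x))
    \<le> potential T Q \<lparr>phase = Fill, buffer = q, gain = g\<rparr>"
proof -
  define p where "p a = sa_arrivals B G a 0 ps (Fill, q)" for a
  let ?F = "\<lambda>x. potential T Q' (sa_finish B G g x)"
  define Y where "Y = real T - (rate + 5) * (real g / real b)"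
  have adm: "admission a 0 q" for a using q(2) by (simp add: admission_def)
  have fin: "finite (set_pmf (p a))" for a
    unfolding p_def by (rule finite_set_pmf_sa_arrivals)
  note res = sa_arrivals_result[OF B q(1) adm q(3) ps(1)]
  have E: "measure_pmf.expectation (bernoulli_pmf r \<bind> p) ?F =
      r * measure_pmf.expectation (p True) ?F + (1 - r) * measure_pmf.expectation (p False) ?F"
    using r by (subst expectation_bind) (auto simp: fin)
  have rhs: "potential T Q \<lparr>phase = Fill, buffer = q, gain = g\<rparr>
      = Y + real (class_jobs G Q) - rate * real (num_GK G q)"
    by (simp add: potential_def Y_def)
  have bound: "?F (ph, q') \<le> Y + (if num_GK G (sa_process G q') = B then 0
      else real (class_jobs G Q')) - rate * num_GK G (sa_process G q')"
    if "(ph, q') \<in> set_pmf (p a)" for ph q' a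
  proof -
    have 1: "length q' \<le> B" "if ph = Fill then num_GK G q' < B else num_GK G q' = B"
      using res[OF that[unfolded p_def]] by (auto simp: unfinished_buffer_def split: if_splits)
    show ?thesis
      using potential_le[OF Q(3) sa_finish_phase[OF 1]]
      unfolding Y_def by (simp add: sa_finish_def)
  qed
  have const: "measure_pmf.expectation (p a) ?F \<le> Z"
    if "\<And>ph q'. (ph, q') \<in> set_pmf (p a) \<Longrightarrow> ?F (ph, q') \<le> Z" for a Z
    using expectation_mono[OF fin, of a ?F "\<lambda>_. Z"] that by auto
  show ?thesis
  proof (cases "num_GK G q + count_known G ps < B")
    case False
    have "?F (ph, q') \<le> Y - rate * real B" if "(ph, q') \<in> set_pmf (p a)" for ph q' a
    proof -
      have "num_GK G q' = B" "length q' \<le> B"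
        using res[OF that[unfolded p_def]] False by (auto simp: unfinished_buffer_def)
      then have "num_GK G (sa_process G q') = B"
        using num_GK_sa_process_mono[of G q'] num_GK_le_length[of G "sa_process G q'"] by simp
      then show ?thesis using bound[OF that] by simp
    qed
    then have "r * measure_pmf.expectation (p True) ?F + (1 - r) * measure_pmf.expectation (p False) ?F
        \<le> r * (Y - rate * real B) + (1 - r) * (Y - rate * real B)"
      using r by (intro add_mono mult_left_mono const) auto
    also have "\<dots> = Y - rate * real B" by (simp add: algebra_simps)
    also have "\<dots> \<le> Y + real (class_jobs G Q) - rate * real (num_GK G q)"
    proof -
      have "rate * real (num_GK G q) \<le> rate * real B"
        using rate_ge_1 q(3) by (intro mult_left_mono) auto
      then show ?thesis by simp
    qed
    finally show ?thesis unfolding p_def[symmetric] E rhs .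
  next
    case True
    define Z where "Z = Y + real (class_jobs G Q') - rate * real (num_GK G q + count_known G ps)"
    define H where "H = measure_pmf.expectation (p True) (\<lambda>(ph, q'). admitted_in G q')"
    have pt: "?F (ph, q') \<le> Z - rate * admitted_in G q'" if x: "(ph, q') \<in> set_pmf (p a)" for ph q' a
    proof -
      obtain m' where m': "admission a m' q'"
        and n: "num_GK G q' = num_GK G q + count_known G ps"
        using res[OF x[unfolded p_def]] True by auto
      have "real (num_GK G q + count_known G ps) + admitted_in G q'
          \<le> real (num_GK G (sa_process G q'))"
        using num_GK_sa_process[of q' G] admission_le[OF m'] admission_unknown[OF m']
        unfolding n[symmetric] admitted_in_def of_nat_add[symmetric] of_nat_le_iff by blast
      then have "rate * (real (num_GK G q + count_known G ps) + admitted_in G q')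
          \<le> rate * real (num_GK G (sa_process G q'))"
        using rate_ge_1 by (intro mult_left_mono) auto
      then show ?thesis
        using bound[OF x] unfolding Z_def distrib_left by (auto split: if_splits)
    qed
    have ETrue: "measure_pmf.expectation (p True) ?F \<le> Z - rate * H"
    proof -
      have "measure_pmf.expectation (p True) ?F
          \<le> measure_pmf.expectation (p True) (\<lambda>x. Z - rate * (case x of (ph, q') \<Rightarrow> admitted_in G q'))"
        using pt by (intro expectation_mono fin) auto
      also have "\<dots> = Z - rate * H"
        unfolding H_def
        by (subst Bochner_Integration.integral_diff) (auto simp: integrable_measure_pmf_finite fin)
      finally show ?thesis .
    qed
    have EFalse: "measure_pmf.expectation (p False) ?F \<le> Z"
    proof (rule const)
      fix ph q' assume "(ph, q') \<in> set_pmf (p False)"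
      from pt[OF this] rate_ge_1 show "?F (ph, q') \<le> Z"
        by (smt (verit) admitted_in_def mult_nonneg_nonneg of_nat_0_le_iff)
    qed
    have H: "H \<ge> 0"
      unfolding H_def by (intro integral_nonneg_AE) (auto simp: admitted_in_def)
    \<comment> \<open>The reservoir identity for \<open>m = 0\<close>. Bounding the number of
      U-packets by \<open>M\<close> and writing \<open>M = r * rate\<close> brings in the
      probability \<open>r\<close> of an admittance cycle.\<close>
    have "real (length (filter (\<lambda>p. \<not> announced p) ps)) * H = real (count_unknown G ps)"
      using sa_arrivals_expectation[OF B q(1) adm True ps(1)] by (simp add: H_def p_def)
    then have "real (count_unknown G ps) \<le> real M * H"
      using mult_right_mono[OF _ H, of "real (length (filter (\<lambda>p. \<not> announced p) ps))" "real M"] ps(2)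
      by simp
    also have "\<dots> = r * (rate * H)" using r by (simp add: rate_def)
    finally have unk: "real (count_unknown G ps) \<le> r * (rate * H)" .
    have "r * measure_pmf.expectation (p True) ?F + (1 - r) * measure_pmf.expectation (p False) ?F
        \<le> r * (Z - rate * H) + (1 - r) * Z"
      using r by (intro add_mono mult_left_mono ETrue EFalse) auto
    also have "\<dots> = Z - r * (rate * H)" by (simp add: algebra_simps)
    also have "\<dots> \<le> Z - real (count_unknown G ps)" using unk by simp
    also have "\<dots> \<le> Y + real (class_jobs G Q) - rate * real (num_GK G q)"
    proof -
      have "class_jobs G Q' \<le> class_jobs G Q + count_known G ps + count_unknown G ps"
        using class_jobs_process[OF Q(2)] class_jobs_arrivals[OF Q(1)] order_trans by blast
      moreover have "real (count_known G ps) \<le> rate * real (count_known G ps)"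
        using mult_right_mono[OF rate_ge_1, of "real (count_known G ps)"] by simp
      ultimately show ?thesis unfolding Z_def by (simp add: distrib_left)
    qed
    finally show ?thesis unfolding p_def[symmetric] E rhs .
  qed
qed

text \<open>SA completes one unit of work while the offline algorithm invests at most one unit in
  the class, and fresh packets carry no service. So \<open>class_service\<close> plus
  \<open>work_left\<close> cannot grow.\<close>

lemma potential_Flush:
  assumes q: "q \<noteq> []" "\<forall>j\<in>set q. \<not> finished j" "num_GK G q = length q"
    and Q: "offline_arrivals B Q ps A" "offline_process A Q'"
  shows "potential T Q' (sa_finish B G g (Flush, q))
    \<le> potential T Q \<lparr>phase = Flush, buffer = q, gain = g\<rparr>"
proof -
  let ?q = "sa_process G q"
  have n: "num_GK G ?q = num_GK G q"
    using q(3) num_GK_sa_process_mono[of G q] num_GK_le_length[of G ?q] by simp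
  have "class_service G Q' + work_left ?q \<le> class_service G Q + work_left q"
    using class_service_process[OF Q(2), of G] class_service_arrivals[OF Q(1), of G]
      work_left_sa_process[OF q(1,2), of G] by simp
  then have "real (class_service G Q' + work_left ?q) / real c
      \<le> real (class_service G Q + work_left q) / real c"
    by (intro divide_right_mono) (simp_all only: of_nat_le_iff of_nat_0_le_iff)
  moreover have "?q \<noteq> []" using q(1) by (metis length_0_conv length_sa_process)
  ultimately show ?thesis by (simp add: potential_def sa_finish_def update_phase_def n)
qed

section \<open>One complete cycle\<close>

context
  fixes s :: sa_state and ps :: "packet list" and q ph g
  assumes inv: "sa_inv B W G s" and ps: "\<forall>p\<in>set ps. work p \<in> {1..W}"
  defines "q \<equiv> filter (\<lambda>j. \<not> finished j) (buffer s)"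
    and "ph \<equiv> update_phase B G q (phase s)"
    and "g \<equiv> gain s + (\<Sum>j\<leftarrow>filter finished (buffer s). profit (pkt j))"
begin

lemma transmitted_buffer:
  shows "unfinished_buffer B W q" "filter admitted q = []"
    and "ph = Fill \<Longrightarrow> num_GK G q < B"
    and "ph = Flush \<Longrightarrow> q \<noteq> [] \<and> num_GK G q = length q"
proof -
  have len: "length q \<le> B"
    unfolding q_def using inv by (auto simp: sa_inv_def intro: order_trans[OF length_filter_le])
  then show "unfinished_buffer B W q"
    using inv by (auto simp: q_def unfinished_buffer_def sa_inv_def finished_def)
  show "filter admitted q = []"
    using inv by (auto simp: q_def sa_inv_def filter_empty_conv)
  have le: "num_GK G q \<le> num_GK G (buffer s)"
    unfolding q_def using num_GK_filter[of G "buffer s" finished] by simp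
  have fl: "num_GK G q = length q" if "phase s = Flush"
    using inv that unfolding num_GK_eq_length q_def sa_inv_def by auto
  show "num_GK G q < B" if "ph = Fill"
    using that inv le len B unfolding ph_def update_phase_def
    by (auto simp: num_GK_def sa_inv_def split: if_splits)
  show "q \<noteq> [] \<and> num_GK G q = length q" if "ph = Flush"
    using that inv le fl unfolding ph_def update_phase_def sa_inv_def
    by (cases "phase s") (auto split: if_splits)
qed

lemma sa_arrivals_phase:
  assumes "(ph', q') \<in> set_pmf (sa_arrivals B G a 0 ps (ph, q))"
  shows "unfinished_buffer B W q'"
    and "if ph' = Fill then num_GK G q' < B else num_GK G q' = length q' \<and> q' \<noteq> []"
proof -
  have "unfinished_buffer B W q' \<and>
    (if ph' = Fill then num_GK G q' < B else num_GK G q' = length q' \<and> q' \<noteq> [])"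
  proof (cases ph)
    case Fill
    have "admission a 0 q" using transmitted_buffer(2) by (simp add: admission_def)
    note res = sa_arrivals_result[OF B transmitted_buffer(1) this transmitted_buffer(3)[OF Fill] ps
        assms[unfolded Fill]]
    then have "unfinished_buffer B W q'" by simp
    moreover have "num_GK G q' = length q' \<and> q' \<noteq> []" if "num_GK G q' = B"
      using that num_GK_le_length[of G q'] B res by (auto simp: unfinished_buffer_def)
    ultimately show ?thesis using res by (auto split: if_splits)
  next
    case Flush
    then show ?thesis using assms transmitted_buffer by auto
  qed
  then show "unfinished_buffer B W q'"
    "if ph' = Fill then num_GK G q' < B else num_GK G q' = length q' \<and> q' \<noteq> []" by auto
qed

lemma sa_inv_cycle:
  assumes "s' \<in> set_pmf (sa_cycle B G r ps s)"
  shows "sa_inv B W G s'"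
proof -
  obtain a ph' q' where x: "(ph', q') \<in> set_pmf (sa_arrivals B G a 0 ps (ph, q))"
    and s': "s' = sa_finish B G g (ph', q')"
    using assms unfolding sa_cycle_eq q_def[symmetric] ph_def[symmetric] g_def[symmetric] by auto
  note y = sa_arrivals_phase[OF x]
  let ?q = "sa_process G q'"
  have len: "length q' \<le> B" using y(1) by (simp add: unfinished_buffer_def)
  have "\<forall>j\<in>set ?q. \<not> admitted j \<and> work (pkt j) \<le> W"
    using y(1) by (intro sa_process_all) (auto simp: unfinished_buffer_def)
  moreover have "num_GK G ?q \<le> length q'" using num_GK_le_length[of G ?q] by simp
  moreover have "?q = [] \<longleftrightarrow> q' = []" by (metis length_0_conv length_sa_process)
  ultimately show ?thesis
    using y(2) len num_GK_sa_process_mono[of G q'] B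
    unfolding s' sa_inv_def sa_finish_def update_phase_def
    by (cases ph') (auto simp: num_GK_def)
qed

text \<open>The supermartingale step: \<open>potential_transmit\<close> handles transmission, and
  \<open>potential_Fill\<close> or \<open>potential_Flush\<close> handles arrivals and processing,
  according to the phase after transmission.\<close>

lemma potential_cycle:
  assumes "length (filter (\<lambda>p. \<not> announced p) ps) \<le> M"
    and Q: "offline_buffer B Q" "offline_arrivals B (filter_mset (\<lambda>j. \<not> finished j) Q) ps A"
      "offline_process A Q'"
  shows "measure_pmf.expectation (sa_cycle B G r ps s)
      (potential (T + class_jobs G (filter_mset finished Q)) Q') \<le> potential T Q s"
proof -
  let ?T = "T + class_jobs G (filter_mset finished Q)"
  let ?p = "bernoulli_pmf r \<bind> (\<lambda>a. sa_arrivals B G a 0 ps (ph, q))"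
  have Q': "offline_buffer B Q'"
    using ps by (intro offline_buffer_step[OF Q(1) _ Q(2,3)]) auto
  have fin: "finite (set_pmf ?p)"
    by (auto simp: finite_set_pmf_sa_arrivals)
  have "measure_pmf.expectation (sa_cycle B G r ps s) (potential ?T Q')
      = measure_pmf.expectation ?p (\<lambda>x. potential ?T Q' (sa_finish B G g x))"
    unfolding sa_cycle_eq q_def[symmetric] ph_def[symmetric] g_def[symmetric]
    by (subst expectation_bind[OF fin]) auto
  also have "\<dots> \<le> potential ?T (filter_mset (\<lambda>j. \<not> finished j) Q)
      \<lparr>phase = ph, buffer = q, gain = g\<rparr>"
  proof (cases ph)
    case Fill
    then show ?thesis
      using potential_Fill[OF transmitted_buffer(1,2) _ ps assms(1) Q(2,3) Q'] transmitted_buffer(3)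
      by simp
  next
    case Flush
    have "\<forall>j\<in>set q. \<not> finished j" by (simp add: q_def)
    then show ?thesis
      using potential_Flush[OF _ _ _ Q(2,3)] transmitted_buffer(4)[OF Flush] Flush by simp
  qed
  also have "\<dots> \<le> potential T Q s"
    unfolding ph_def g_def by (rule potential_transmit[OF inv Q(1)]) (simp add: q_def)
  finally show ?thesis .
qed

end

section \<open>Draining and the bound for whole runs\<close>

lemma sa_cycle_drain:
  assumes "s' \<in> set_pmf (sa_cycle B G r [] s)"
  shows "buffer s' = [] \<or> Suc (work_left (buffer s')) = work_left (buffer s)"
proof -
  define q where "q = filter (\<lambda>j. \<not> finished j) (buffer s)"
  have s': "buffer s' = sa_process G q"
    using assms unfolding sa_cycle_eq q_def[symmetric] by (auto simp: sa_finish_def)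
  have "work_left q = work_left (buffer s)"
    unfolding q_def by (rule work_left_unfinished)
  moreover have "\<forall>j\<in>set q. \<not> finished j" by (simp add: q_def)
  ultimately show ?thesis
    using work_left_sa_process[of q G] unfolding s' by (cases "q = []") simp_all
qed

context
  fixes V \<sigma> Q
  assumes \<sigma>: "valid_arrivals M W V \<sigma>" and Q: "offline_schedule B \<sigma> Q"
begin

lemma arrivals_valid:
  "\<forall>p\<in>set (arrivals \<sigma> t). work p \<in> {1..W}"
  "length (filter (\<lambda>p. \<not> announced p) (arrivals \<sigma> t)) \<le> M"
  using \<sigma> by (auto simp: valid_arrivals_def arrivals_def)

lemma offline_schedule_buffer: "offline_buffer B (Q t)"
proof (induction t)
  case 0
  then show ?case using Q by (simp add: offline_schedule_def offline_buffer_def)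
next
  case (Suc t)
  then show ?case
    using Q arrivals_valid(1)[of t] offline_buffer_step[of B "Q t" "arrivals \<sigma> t"]
    unfolding offline_schedule_def by fastforce
qed

lemma sa_run_inv: "s \<in> set_pmf (sa_run B G r \<sigma> n) \<Longrightarrow> sa_inv B W G s"
proof (induction n arbitrary: s)
  case 0
  then show ?case using B by (simp add: sa_inv_def num_GK_def)
next
  case (Suc n)
  then show ?case using sa_inv_cycle[OF _ arrivals_valid(1)] by auto
qed

lemma potential_run:
  "measure_pmf.expectation (sa_run B G r \<sigma> n)
    (potential (\<Sum>t<n. class_jobs G (filter_mset finished (Q t))) (Q n)) \<le> 0"
proof (induction n)
  case 0
  have "Q 0 = {#}" using Q by (simp add: offline_schedule_def)
  then show ?case by (simp add: potential_def class_jobs_def num_GK_def)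
next
  case (Suc n)
  let ?T = "\<lambda>n. \<Sum>t<n. class_jobs G (filter_mset finished (Q t))"
  obtain A where A: "offline_arrivals B (filter_mset (\<lambda>j. \<not> finished j) (Q n)) (arrivals \<sigma> n) A"
    "offline_process A (Q (Suc n))"
    using Q unfolding offline_schedule_def by blast
  have "measure_pmf.expectation (sa_run B G r \<sigma> (Suc n)) (potential (?T (Suc n)) (Q (Suc n)))
      = measure_pmf.expectation (sa_run B G r \<sigma> n) (\<lambda>s.
          measure_pmf.expectation (sa_cycle B G r (arrivals \<sigma> n) s)
            (potential (?T n + class_jobs G (filter_mset finished (Q n))) (Q (Suc n))))"
    unfolding sa_run.simps
    by (subst expectation_bind)
      (auto simp: finite_set_pmf_sa_run sa_cycle_eq finite_set_pmf_sa_arrivals)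
  also have "\<dots> \<le> measure_pmf.expectation (sa_run B G r \<sigma> n) (potential (?T n) (Q n))"
    using potential_cycle[OF sa_run_inv arrivals_valid offline_schedule_buffer A]
    by (intro expectation_mono finite_set_pmf_sa_run) auto
  finally show ?case using Suc by linarith
qed

text \<open>After the last arrivals at most \<open>B\<close> packets of work at most
  \<open>W\<close> remain and SA never idles, so the buffer is empty once
  \<open>k > W * B\<close>.\<close>

lemma sa_run_drain:
  "s \<in> set_pmf (sa_run B G r \<sigma> (length \<sigma> + k)) \<Longrightarrow>
    buffer s = [] \<or> work_left (buffer s) + k \<le> W * B"
proof (induction k arbitrary: s)
  case 0
  then show ?case
    using sa_run_inv[of s "length \<sigma>"] work_left_le[of "buffer s" W B] by (auto simp: sa_inv_def)
next
  case (Suc k)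
  then obtain s0 where s0: "s0 \<in> set_pmf (sa_run B G r \<sigma> (length \<sigma> + k))"
    "s \<in> set_pmf (sa_cycle B G r [] s0)"
    by (auto simp: arrivals_def)
  \<comment> \<open>An empty buffer has \<open>work_left\<close> 0, so the second alternative of
    \<open>sa_cycle_drain\<close> is impossible and the buffer stays empty.\<close>
  show ?case
    using Suc.IH[OF s0(1)] sa_cycle_drain[OF s0(2)] by (auto simp: work_left_def)
qed

text \<open>For such \<open>n\<close> the buffer of SA is empty, so the phase term of the potential
  is nonnegative and only the counters remain. The factor 6 comes from
  \<open>rate + 5 \<le> 6 * rate\<close>.\<close>

lemma class_throughput:
  assumes "n > length \<sigma> + W * B"
  shows "real b * real (\<Sum>t<n. class_jobs G (filter_mset finished (Q t)))
    \<le> 6 * rate * measure_pmf.expectation (sa_run B G r \<sigma> n) (\<lambda>s. real (gain s))"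
proof -
  let ?T = "\<Sum>t<n. class_jobs G (filter_mset finished (Q t))" and ?p = "sa_run B G r \<sigma> n"
  let ?E = "measure_pmf.expectation ?p (\<lambda>s. real (gain s))"
  have "real ?T - (rate + 5) * (?E / real b)
      = measure_pmf.expectation ?p (\<lambda>s. real ?T - (rate + 5) * (real (gain s) / real b))"
    by (subst Bochner_Integration.integral_diff)
      (auto simp: integrable_measure_pmf_finite finite_set_pmf_sa_run)
  also have "\<dots> \<le> measure_pmf.expectation ?p (potential ?T (Q n))"
  proof (intro expectation_mono finite_set_pmf_sa_run)
    fix s assume s: "s \<in> set_pmf ?p"
    have "buffer s = []"
      using sa_run_drain[of s "n - length \<sigma>"] s assms by auto
    then show "real ?T - (rate + 5) * (real (gain s) / real b) \<le> potential ?T (Q n) s"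
      by (cases "phase s") (simp_all add: potential_def num_GK_def)
  qed
  also have "\<dots> \<le> 0" by (rule potential_run)
  finally have "real b * real ?T \<le> (rate + 5) * ?E"
    using b by (simp add: field_simps)
  also have "\<dots> \<le> 6 * rate * ?E"
    using rate_ge_1 by (intro mult_right_mono) (auto intro: integral_nonneg_AE)
  finally show ?thesis .
qed

end

end

section \<open>Summation over the classes\<close>

lemma X_subset: "i \<ge> 1 \<Longrightarrow> X i \<subseteq> {2 ^ (i - 1)..2 * 2 ^ (i - 1)}"
  by (cases i) (auto simp: X_def)

lemma X_cover:
  assumes "n \<in> {1..2 ^ k}" "k \<ge> 1"
  shows "\<exists>i\<in>{1..k}. n \<in> X i"
  using assms(2,1)
proof (induction k rule: dec_induct)
  case base
  then show ?case by (auto simp: X_def)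
next
  case (step k)
  show ?case
  proof (cases "n \<le> 2 ^ k")
    case True
    then show ?thesis using step by fastforce
  next
    case False
    then have "n \<in> X (Suc k)" using step by (auto simp: X_def)
    then show ?thesis by auto
  qed
qed

lemma num_classes_power: "num_classes (2 ^ k) = k"
  by (simp add: num_classes_def log_nat_power)

lemma sum_mset_swap:
  fixes f :: "'a \<Rightarrow> 'b \<Rightarrow> nat"
  shows "(\<Sum>j\<in>#Q. \<Sum>x\<in>S. f x j) = (\<Sum>x\<in>S. \<Sum>j\<in>#Q. f x j)"
  by (induction Q) (simp_all add: sum.distrib)

lemma offline_schedule_packets:
  assumes "valid_arrivals M W V \<sigma>" "offline_schedule B \<sigma> Q"
  shows "\<forall>j\<in>#Q t. work (pkt j) \<in> {1..W} \<and> profit (pkt j) \<in> {1..V}"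
proof (induction t)
  case 0
  then show ?case using assms(2) by (simp add: offline_schedule_def)
next
  case (Suc t)
  let ?P = "\<lambda>j::job. work (pkt j) \<in> {1..W} \<and> profit (pkt j) \<in> {1..V}"
  obtain A where A: "offline_arrivals B (filter_mset (\<lambda>j. \<not> finished j) (Q t)) (arrivals \<sigma> t) A"
    "offline_process A (Q (Suc t))"
    using assms(2) unfolding offline_schedule_def by blast
  have "\<forall>j\<in>#A. ?P j"
    using Suc assms(1)
    by (intro offline_arrivals_all[OF A(1)]) (auto simp: valid_arrivals_def arrivals_def)
  then show ?case
    by (rule offline_process_all[OF A(2)]) (auto simp: serve_def)
qed

text \<open>The class is uniform among \<open>kW * kV\<close> candidates; this average is where the
  two logarithms enter the competitive ratio.\<close>

lemma expectation_SA:
  assumes "\<And>i j. finite (set_pmf (sa_run B (combined_class i j) r \<sigma> n))" "kW \<ge> 1" "kV \<ge> 1"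
  shows "real kW * real kV * measure_pmf.expectation (SA B (2 ^ kW) (2 ^ kV) r \<sigma> n) h =
    (\<Sum>i\<in>{1..kW}. \<Sum>j\<in>{1..kV}. measure_pmf.expectation (sa_run B (combined_class i j) r \<sigma> n) h)"
proof -
  have [simp]: "{1..k} \<noteq> {}" if "k \<ge> 1" for k :: nat using that by auto
  have "measure_pmf.expectation (SA B (2 ^ kW) (2 ^ kV) r \<sigma> n) h =
    (\<Sum>i\<in>{1..kW}. (\<Sum>j\<in>{1..kV}.
       measure_pmf.expectation (sa_run B (combined_class i j) r \<sigma> n) h / real kV) / real kW)"
    using assms unfolding SA_def num_classes_power
    by (simp add: pmf_expectation_bind_pmf_of_set divide_inverse mult.commute)
  then show ?thesis
    using assms(2,3) by (simp flip: sum_divide_distrib)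
qed

text \<open>A packet is worth at most twice the lower bound \<open>2 ^ (j - 1)\<close> of its profit
  class \<open>j\<close>, and \<open>class_throughput\<close> contributes the factor 6; together
  they give 12.\<close>

lemma partial_throughput_le:
  assumes B: "B \<ge> 2" and M: "M \<ge> 1" and r: "0 < r" "r \<le> 1" and k: "kW \<ge> 1" "kV \<ge> 1"
    and \<sigma>: "valid_arrivals M (2 ^ kW) (2 ^ kV) \<sigma>" and Q: "offline_schedule B \<sigma> Q"
    and n: "n > length \<sigma> + 2 ^ kW * B"
  shows "real (\<Sum>t<n. \<Sum>j\<in>#filter_mset finished (Q t). profit (pkt j))
    \<le> 12 * (real M / r * real kW * real kV)
      * measure_pmf.expectation (SA B (2 ^ kW) (2 ^ kV) r \<sigma> n) (\<lambda>s. real (gain s))"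
proof -
  let ?S = "{1..kW} \<times> {1..kV}"
  let ?G = "\<lambda>(i, j). combined_class i j"
  let ?fin = "\<lambda>t. filter_mset finished (Q t)"
  let ?E = "\<lambda>x. measure_pmf.expectation (sa_run B (?G x) r \<sigma> n) (\<lambda>s. real (gain s))"
  \<comment> \<open>One class containing the packet already gives the bound; the other summands are
    nonnegative.\<close>
  have cover: "profit p \<le> (\<Sum>x\<in>?S. 2 * 2 ^ (snd x - 1) * of_bool (p \<in> ?G x))"
    if p: "work p \<in> {1..2 ^ kW}" "profit p \<in> {1..2 ^ kV}" for p
  proof -
    obtain i j where ij: "(i, j) \<in> ?S" "work p \<in> X i" "profit p \<in> X j"
      using X_cover[OF p(1) k(1)] X_cover[OF p(2) k(2)] by auto
    then have "profit p \<le> 2 * 2 ^ (j - 1)" using X_subset[of j] by auto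
    also have "\<dots> = 2 * 2 ^ (snd (i, j) - 1) * of_bool (p \<in> ?G (i, j))"
      using ij by (simp add: combined_class_def)
    also have "\<dots> \<le> (\<Sum>x\<in>?S. 2 * 2 ^ (snd x - 1) * of_bool (p \<in> ?G x))"
      using ij(1) by (intro member_le_sum) auto
    finally show ?thesis .
  qed
  have "(\<Sum>t<n. \<Sum>j\<in>#?fin t. profit (pkt j))
      \<le> (\<Sum>t<n. \<Sum>j\<in>#?fin t. \<Sum>x\<in>?S. 2 * 2 ^ (snd x - 1) * of_bool (pkt j \<in> ?G x))"
    using offline_schedule_packets[OF \<sigma> Q] cover
    by (intro sum_mono sum_mset_mono) auto
  also have "\<dots> = (\<Sum>x\<in>?S. 2 * 2 ^ (snd x - 1) * (\<Sum>t<n. class_jobs (?G x) (?fin t)))"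
    unfolding sum_mset_swap class_jobs_def
    by (subst sum.swap) (simp only: sum_mset_distrib_left sum_distrib_left)
  finally have "real (\<Sum>t<n. \<Sum>j\<in>#?fin t. profit (pkt j))
      \<le> real (\<Sum>x\<in>?S. 2 * 2 ^ (snd x - 1) * (\<Sum>t<n. class_jobs (?G x) (?fin t)))"
    by (simp only: of_nat_le_iff)
  also have "\<dots> = (\<Sum>x\<in>?S. 2 * (real (2 ^ (snd x - 1)) * real (\<Sum>t<n. class_jobs (?G x) (?fin t))))"
    by (simp add: mult.assoc)
  also have "\<dots> \<le> (\<Sum>x\<in>?S. 2 * (6 * (real M / r) * ?E x))"
  proof (intro sum_mono mult_left_mono)
    fix x assume "x \<in> ?S"
    then obtain i j where x: "x = (i, j)" "i \<ge> 1" "j \<ge> 1" by auto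
    interpret sa_class B M "2 ^ kW" "2 ^ (i - 1)" "2 ^ (j - 1)" r "combined_class i j"
      using B M r x X_subset[of i] X_subset[of j]
      by unfold_locales (auto simp: combined_class_def)
    show "real (2 ^ (snd x - 1)) * real (\<Sum>t<n. class_jobs (?G x) (?fin t))
        \<le> 6 * (real M / r) * ?E x"
      using class_throughput[OF \<sigma> Q n] x(1) by (simp add: rate_def)
  qed simp
  also have "\<dots> = 12 * (real M / r) * (\<Sum>i\<in>{1..kW}. \<Sum>j\<in>{1..kV}. ?E (i, j))"
    by (simp add: sum_distrib_left sum.cartesian_product case_prod_unfold mult.assoc)
  also have "(\<Sum>i\<in>{1..kW}. \<Sum>j\<in>{1..kV}. ?E (i, j)) = real kW * real kV *
      measure_pmf.expectation (SA B (2 ^ kW) (2 ^ kV) r \<sigma> n) (\<lambda>s. real (gain s))"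
    using k finite_set_pmf_sa_run by (subst expectation_SA) auto
  finally show ?thesis by (simp add: mult.assoc)
qed

theorem corollary12:
  shows "\<exists>C::real. C > 0 \<and>
    (\<forall>(B::nat) (M::nat) (W::nat) (V::nat) (r::real).
       B \<ge> 2 \<longrightarrow> M \<ge> 1 \<longrightarrow>
       W > 1 \<longrightarrow> (\<exists>k. W = 2 ^ k) \<longrightarrow>
       V > 1 \<longrightarrow> (\<exists>k. V = 2 ^ k) \<longrightarrow>
       0 < r \<longrightarrow> r \<le> 1 \<longrightarrow>
       SA_competitive B M W V r
         (C * (real M / r * log 2 (real W) * log 2 (real V))))"
proof (intro exI[of _ 12] conjI allI impI)
  fix B M W V :: nat and r :: real
  assume B: "B \<ge> 2" and M: "M \<ge> 1" and W: "W > 1" "\<exists>k. W = 2 ^ k"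
    and V: "V > 1" "\<exists>k. V = 2 ^ k" and r: "0 < r" "r \<le> 1"
  obtain kW kV where W2: "W = 2 ^ kW" and V2: "V = 2 ^ kV" using W V by blast
  have k: "kW \<ge> 1" "kV \<ge> 1" using W V by (auto simp: W2 V2 Suc_le_eq intro!: Nat.gr0I)
  define c where "c = 12 * (real M / r * real kW * real kV)"
  have c: "c \<ge> 0" using r by (simp add: c_def)
  have "offline_throughput Q \<le> ennreal c * SA_throughput B W V r \<sigma>"
    if \<sigma>: "valid_arrivals M W V \<sigma>" and Q: "offline_schedule B \<sigma> Q" for \<sigma> Q
  proof -
    let ?f = "\<lambda>t. \<Sum>j\<in>#filter_mset finished (Q t). profit (pkt j)"
    have "(\<Sum>t<n. of_nat (?f t)) \<le> ennreal c * SA_throughput B W V r \<sigma>" for n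
    proof -
      \<comment> \<open>Enlarging the horizon only increases the partial sum and takes it past the
        time by which SA has drained its buffer.\<close>
      define n' where "n' = n + Suc (length \<sigma> + W * B)"
      let ?p = "SA B W V r \<sigma> n'"
      have fin: "finite (set_pmf ?p)"
        using k by (auto simp: SA_def W2 V2 num_classes_power finite_set_pmf_sa_run set_pmf_of_set)
      have "(\<Sum>t<n. of_nat (?f t)) \<le> (of_nat (\<Sum>t<n'. ?f t) :: ennreal)"
        unfolding of_nat_sum by (intro sum_mono2) (auto simp: n'_def)
      also have "\<dots> = ennreal (real (\<Sum>t<n'. ?f t))"
        by (rule ennreal_of_nat_eq_real_of_nat)
      also have "\<dots> \<le> ennreal (c * measure_pmf.expectation ?p (\<lambda>s. real (gain s)))"
        using partial_throughput_le[OF B M r k \<sigma>[unfolded W2 V2] Q, of n']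
        by (intro ennreal_leI) (simp add: c_def n'_def W2 V2)
      also have "\<dots> = ennreal c * (\<integral>\<^sup>+ s. of_nat (gain s) \<partial>measure_pmf ?p)"
        using c fin
        by (simp add: ennreal_mult' ennreal_of_nat_eq_real_of_nat nn_integral_eq_integral
            integrable_measure_pmf_finite)
      also have "\<dots> \<le> ennreal c * SA_throughput B W V r \<sigma>"
        unfolding SA_throughput_def by (intro mult_left_mono SUP_upper) auto
      finally show ?thesis .
    qed
    then show ?thesis
      unfolding offline_throughput_def by (intro suminf_le_const summableI)
  qed
  then show "SA_competitive B M W V r (12 * (real M / r * log 2 (real W) * log 2 (real V)))"
    unfolding SA_competitive_def c_def by (simp add: W2 V2 log_nat_power)
qed simp

end
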